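(* Let $X$ be a two-dimensional subshift of finite type with the bounded signal property, and suppose that $X$ is countable or downward deterministic. Then there is some $k \in \mathbb{N}$ such that $X$ does not contain a chain of length $k$ in its subpattern order; that is, there are no $x_1, \ldots, x_k \in X$ with $x_1 > x_2 > \cdots > x_k$.
   Context: Let $S$ be a finite set and give $S^{\mathbb{Z}^d}$ the product topology. Shifts are $\sigma^{\vec n}(x)_{\vec m} = x_{\vec n+\vec m}$. A subshift is a closed shift-invariant subset of $S^{\mathbb{Z}^d}$; it is of finite type (an SFT) if it is the set of configurations avoiding a finite set of forbidden finite patterns. A block map is a continuous shift-commuting map between subshifts; two subshifts are conjugate if there is a bijective block map between them. Subpattern order. For $x \in S^{\mathbb{Z}^2}$ let $\mathcal{B}(x)$ be the set of finite patterns occurring in $x$ (up to translation). Write $x \le y$ if $\mathcal{B}(x) \subset \mathcal{B}(y)$, and $x<y$ if $x \le y$ and not $y \le x$. Determinism. Let $H = \{(a,b) \in \mathbb{Z}^2 : b \ge 1\}$. $X \subset S^{\mathbb{Z}^2}$ is downward (southward) deterministic if every configuration of the half-plane $H$ extends to at most one element of $X$ (i.e. $y,y' \in X$ with $y|_H = y'|_H$ implies $y=y'$). Bounded signal property. The projective subdynamics of $X$ is the set of its horizontal rows, $PS(X) = \{ (x_{(j,0)})_{j \in \mathbb{Z}} : x \in X\}$. $X$ has the bounded signal property if some $\tilde X$ conjugate to $X$ satisfies $PS(\tilde X) \subset Y$ for some countable one-dimensional SFT $Y$. *)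

theory Defs
  imports "HOL-Analysis.Analysis"
begin

text \<open>
  Configurations are functions on an abelian group \<open>'g\<close>, used below with \<open>'g = int\<close> and
  \<open>'g = int \<times> int\<close> (with componentwise addition).  The alphabet is an explicit finite set, and
  \<open>full_shift S\<close> is the product space over \<open>'g\<close> of copies of the discrete space \<open>S\<close>.
\<close>

definition full_shift :: "'a set \<Rightarrow> ('g \<Rightarrow> 'a) topology" where
  "full_shift S = product_topology (\<lambda>_. discrete_topology S) UNIV"

definition shift :: "'g::ab_group_add \<Rightarrow> ('g \<Rightarrow> 'a) \<Rightarrow> 'g \<Rightarrow> 'a" where
  "shift n x = (\<lambda>m. x (n + m))"

definition subshift :: "'a set \<Rightarrow> ('g::ab_group_add \<Rightarrow> 'a) set \<Rightarrow> bool" where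
  "subshift S X \<longleftrightarrow> finite S \<and> closedin (full_shift S) X \<and> (\<forall>n. \<forall>x\<in>X. shift n x \<in> X)"

text \<open>A pattern is a partial map; its domain is the shape of the pattern.\<close>

definition occurs_in :: "('g::ab_group_add \<rightharpoonup> 'a) \<Rightarrow> ('g \<Rightarrow> 'a) \<Rightarrow> bool" where
  "occurs_in p x \<longleftrightarrow> (\<exists>n. \<forall>m\<in>dom p. p m = Some (shift n x m))"

definition sft :: "'a set \<Rightarrow> ('g::ab_group_add \<Rightarrow> 'a) set \<Rightarrow> bool" where
  "sft S X \<longleftrightarrow> subshift S X \<and>
     (\<exists>F. finite F \<and> (\<forall>p\<in>F. finite (dom p) \<and> ran p \<subseteq> S) \<and>
          X = {x \<in> topspace (full_shift S). \<forall>p\<in>F. \<not> occurs_in p x})"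

definition block_map ::
  "'a set \<Rightarrow> ('g::ab_group_add \<Rightarrow> 'a) set \<Rightarrow> 'b set \<Rightarrow> ('g \<Rightarrow> 'b) set
     \<Rightarrow> (('g \<Rightarrow> 'a) \<Rightarrow> ('g \<Rightarrow> 'b)) \<Rightarrow> bool" where
  "block_map S X T Y f \<longleftrightarrow>
     continuous_map (subtopology (full_shift S) X) (subtopology (full_shift T) Y) f \<and>
     (\<forall>n. \<forall>x\<in>X. f (shift n x) = shift n (f x))"

definition conjugate ::
  "'a set \<Rightarrow> ('g::ab_group_add \<Rightarrow> 'a) set \<Rightarrow> 'b set \<Rightarrow> ('g \<Rightarrow> 'b) set \<Rightarrow> bool" where
  "conjugate S X T Y \<longleftrightarrow> subshift S X \<and> subshift T Y \<and>
     (\<exists>f. block_map S X T Y f \<and> bij_betw f X Y)"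

text \<open>
  All translates of an occurring pattern are included, so that inclusion of these sets is
  inclusion of patterns up to translation.
\<close>

definition patterns_of :: "('g::ab_group_add \<Rightarrow> 'a) \<Rightarrow> ('g \<rightharpoonup> 'a) set" where
  "patterns_of x = {p. finite (dom p) \<and> occurs_in p x}"

definition subpattern_le :: "('g::ab_group_add \<Rightarrow> 'a) \<Rightarrow> ('g \<Rightarrow> 'a) \<Rightarrow> bool" where
  "subpattern_le x y \<longleftrightarrow> patterns_of x \<subseteq> patterns_of y"

definition subpattern_less :: "('g::ab_group_add \<Rightarrow> 'a) \<Rightarrow> ('g \<Rightarrow> 'a) \<Rightarrow> bool" where
  "subpattern_less x y \<longleftrightarrow> subpattern_le x y \<and> \<not> subpattern_le y x"

definition upper_half_plane :: "(int \<times> int) set" where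
  "upper_half_plane = {(a, b). b \<ge> 1}"

definition downward_deterministic :: "(int \<times> int \<Rightarrow> 'a) set \<Rightarrow> bool" where
  "downward_deterministic X \<longleftrightarrow>
     (\<forall>y\<in>X. \<forall>y'\<in>X. (\<forall>v\<in>upper_half_plane. y v = y' v) \<longrightarrow> y = y')"

definition projective_subdynamics :: "(int \<times> int \<Rightarrow> 'a) set \<Rightarrow> (int \<Rightarrow> 'a) set" where
  "projective_subdynamics X = (\<lambda>x j. x (j, 0)) ` X"

text \<open>
  The conjugate subshift may have any finite alphabet; up to renaming of symbols this is a
  finite set of natural numbers.
\<close>

definition bounded_signal_property :: "'a set \<Rightarrow> (int \<times> int \<Rightarrow> 'a) set \<Rightarrow> bool" where
  "bounded_signal_property S X \<longleftrightarrow>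
     (\<exists>(T :: nat set) X' (U :: nat set) Y.
        conjugate S X T X' \<and> sft U Y \<and> countable Y \<and> projective_subdynamics X' \<subseteq> Y)"

end

theory Submission
  imports Defs
begin

text \<open>
  In a countable SFT the loops at a fixed word commute, since otherwise they could be concatenated
  freely in uncountably many ways.  In dimension one this bounds the number of defects, that is,
  of positions where a row differs from its translate by a common period \<open>p\<close>.  Now let \<open>x\<close> and \<open>y\<close> be in the
  conjugate of \<open>X\<close>, let \<open>y \<le> x\<close>, and suppose that both have the same maximal number of defects in
  blocks of \<open>r\<close> consecutive rows.  A maximal block of \<open>y\<close> then recurs exactly as a full block of rows
  of \<open>x\<close>.  If the heights of the recurrences are bounded, \<open>y\<close> is a translate of \<open>x\<close>.  Otherwise
  either commutation of loops (of slabs, in the countable case) or determinism makes \<open>x\<close>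
  periodic along the recurrences, hence \<open>y\<close> has a non-horizontal period, unless \<open>x \<le> y\<close>.
  A configuration with such a period lies below each \<open>z \<le> y\<close> with the same maximal number of
  defects, so this number drops at least once in two strict steps.
\<close>

section \<open>Compactness and local rules\<close>

lemma topspace_full_shift: "topspace (full_shift S) = {x. \<forall>m. x m \<in> S}"
  by (auto simp: full_shift_def PiE_def Pi_def)

lemma continuous_map_full_shift_component:
  "continuous_map (full_shift S) (discrete_topology S) (\<lambda>x. x m)"
  unfolding full_shift_def by (rule continuous_map_product_projection) simp

text \<open>A point outside \<open>X\<close> has a basic open neighbourhood missing
  \<open>X\<close>. It constrains only finitely many coordinates, and on those some element of
  \<open>X\<close> agrees with \<open>z\<close>.\<close>

lemma closedin_full_shift_limit:
  assumes "closedin (full_shift S) X"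
    and approx: "\<And>A. finite A \<Longrightarrow> \<exists>x\<in>X. \<forall>m\<in>A. x m = z m"
  shows "z \<in> X"
proof (rule ccontr)
  assume "z \<notin> X"
  have X: "X \<subseteq> topspace (full_shift S)"
    using assms(1) by (rule closedin_subset)
  have z: "z m \<in> S" for m
  proof -
    obtain x where "x \<in> X" "x m = z m" using approx[of "{m}"] by auto
    then show ?thesis using X by (metis (mono_tags) mem_Collect_eq subsetD topspace_full_shift)
  qed
  have "openin (full_shift S) (topspace (full_shift S) - X)"
    using assms(1) by (simp add: closedin_def)
  then have "\<forall>u\<in>topspace (full_shift S) - X. \<exists>B. finite {m \<in> UNIV. B m \<noteq> topspace (discrete_topology S)} \<and>
      (\<forall>m\<in>UNIV. openin (discrete_topology S) (B m)) \<and> u \<in> Pi\<^sub>E UNIV B \<and>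
      Pi\<^sub>E UNIV B \<subseteq> topspace (full_shift S) - X"
    unfolding full_shift_def openin_product_topology_alt .
  moreover have "z \<in> topspace (full_shift S) - X"
    using z \<open>z \<notin> X\<close> by (simp add: topspace_full_shift)
  ultimately obtain B where "finite {m \<in> UNIV. B m \<noteq> topspace (discrete_topology S)}"
    and B: "z \<in> Pi\<^sub>E UNIV B" "Pi\<^sub>E UNIV B \<subseteq> topspace (full_shift S) - X"
    by meson
  then have "finite {m. B m \<noteq> S}" by simp
  then have "\<exists>x\<in>X. \<forall>m\<in>{m. B m \<noteq> S}. x m = z m" by (rule approx)
  then obtain x where x: "x \<in> X" "\<And>m. B m \<noteq> S \<Longrightarrow> x m = z m" by auto
  have "x m \<in> B m" for m
  proof (cases "B m = S")
    case True
    then show ?thesis using x(1) X by (auto simp: topspace_full_shift)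
  next
    case False
    then show ?thesis using x(2) B(1) by (simp add: PiE_def Pi_def)
  qed
  then show False
    using B(2) x(1) by (auto simp: PiE_def)
qed

lemma openin_compare_discrete:
  assumes "continuous_map Z (discrete_topology T) f" "continuous_map Z (discrete_topology T) g"
  shows "openin Z {z \<in> topspace Z. P (f z) (g z)}"
proof -
  have "continuous_map Z (discrete_topology (T \<times> T)) (\<lambda>z. (f z, g z))"
    using assms by (simp add: continuous_map_paired prod_topology_discrete_topology)
  moreover have "openin (discrete_topology (T \<times> T)) {t \<in> T \<times> T. P (fst t) (snd t)}"
    by auto
  ultimately have "openin Z {z \<in> topspace Z. (f z, g z) \<in> {t \<in> T \<times> T. P (fst t) (snd t)}}"
    by (rule openin_continuous_map_preimage)
  moreover have "{z \<in> topspace Z. (f z, g z) \<in> {t \<in> T \<times> T. P (fst t) (snd t)}}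
      = {z \<in> topspace Z. P (f z) (g z)}"
    using assms by (auto simp: continuous_map_def)
  ultimately show ?thesis by simp
qed

text \<open>The pairs in \<open>X \<times> X\<close> on which \<open>h\<close> differs form a
  compact set, covered by the open sets where the observations \<open>g\<close> differ at some
  \<open>m\<close> in \<open>B\<close>; a finite subcover gives \<open>A\<close>. The form is
  general enough to yield windows for block maps and their inverses as well as finite-range
  determinism.\<close>

lemma compact_finite_determination:
  fixes g :: "('g \<Rightarrow> 'a) \<Rightarrow> 'h \<Rightarrow> 'b"
  assumes "finite S" "closedin (full_shift S) X"
    and g: "\<And>m. m \<in> B \<Longrightarrow> continuous_map (subtopology (full_shift S) X) (discrete_topology T) (\<lambda>x. g x m)"
    and h: "continuous_map (subtopology (full_shift S) X) (discrete_topology V) h"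
    and det: "\<And>x y. x \<in> X \<Longrightarrow> y \<in> X \<Longrightarrow> (\<And>m. m \<in> B \<Longrightarrow> g x m = g y m) \<Longrightarrow> h x = h y"
  shows "\<exists>A. finite A \<and> A \<subseteq> B \<and>
    (\<forall>x\<in>X. \<forall>y\<in>X. (\<forall>m\<in>A. g x m = g y m) \<longrightarrow> h x = h y)"
proof -
  define XX where "XX = subtopology (full_shift S) X"
  define Z where "Z = prod_topology XX XX"
  have X: "X \<subseteq> topspace (full_shift S)"
    using assms(2) by (rule closedin_subset)
  then have topZ: "topspace Z = X \<times> X"
    by (auto simp: Z_def XX_def topspace_subtopology)
  have "compact_space (full_shift S)"
    unfolding full_shift_def using assms(1)
    by (auto simp: compact_space_product_topology compact_space_discrete_topology)
  then have "compactin (full_shift S) X"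
    using assms(2) by (rule closedin_compact_space)
  then have "compact_space XX"
    unfolding XX_def by (rule compact_space_subtopology)
  then have compZ: "compact_space Z"
    unfolding Z_def by (simp add: compact_space_prod_topology)
  have comp_fst: "continuous_map Z W (\<lambda>z. u (fst z))" and comp_snd: "continuous_map Z W (\<lambda>z. u (snd z))"
    if "continuous_map XX W u" for W :: "'w topology" and u
    using continuous_map_compose[OF continuous_map_fst that]
      continuous_map_compose[OF continuous_map_snd that]
    by (simp_all add: Z_def o_def)
  define D where "D m = {z \<in> topspace Z. g (fst z) m \<noteq> g (snd z) m}" for m
  have D: "openin Z (D m)" if "m \<in> B" for m
    unfolding D_def
    by (rule openin_compare_discrete[where P = "(\<noteq>)"])
      (rule comp_fst comp_snd, unfold XX_def, rule g[OF that])+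
  have E: "openin Z {z \<in> topspace Z. h (fst z) = h (snd z)}" (is "openin Z ?E")
    by (rule openin_compare_discrete[where P = "(=)"])
      (rule comp_fst comp_snd, unfold XX_def, rule h)+
  have "closedin Z (topspace Z - ?E)"
    using E by (rule closedin_diff[OF closedin_topspace])
  then have "compactin Z (topspace Z - ?E)"
    using compZ by (intro closedin_compact_space)
  moreover have "topspace Z - ?E \<subseteq> \<Union>(D ` B)"
  proof
    fix z assume "z \<in> topspace Z - ?E"
    then have "fst z \<in> X" "snd z \<in> X" "h (fst z) \<noteq> h (snd z)" "z \<in> topspace Z"
      by (auto simp: topZ)
    then obtain m where "m \<in> B" "g (fst z) m \<noteq> g (snd z) m"
      using det by metis
    then show "z \<in> \<Union>(D ` B)"
      using \<open>z \<in> topspace Z\<close> by (auto simp: D_def)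
  qed
  moreover have "\<And>U. U \<in> D ` B \<Longrightarrow> openin Z U"
    using D by blast
  ultimately obtain F where F: "finite F" "F \<subseteq> D ` B" "topspace Z - ?E \<subseteq> \<Union>F"
    by (meson compactinD)
  then obtain A where A: "A \<subseteq> B" "finite A" "F = D ` A"
    by (meson finite_subset_image)
  have "h x = h y" if xy: "x \<in> X" "y \<in> X" and eq: "\<forall>m\<in>A. g x m = g y m" for x y
  proof -
    have "(x, y) \<notin> \<Union>F"
      using eq A(3) by (auto simp: D_def)
    then show "h x = h y"
      using F(3) xy by (auto simp: topZ)
  qed
  then show ?thesis using A(1,2) by blast
qed

section \<open>Sliding block codes and conjugacies\<close>

lemma block_map_component_continuous:
  assumes "block_map S X T Y f"
  shows "continuous_map (subtopology (full_shift S) X) (discrete_topology T) (\<lambda>x. f x m)"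
proof -
  have "continuous_map (subtopology (full_shift S) X) (full_shift T) f"
    using assms by (auto simp: block_map_def continuous_map_in_subtopology)
  from continuous_map_compose[OF this continuous_map_full_shift_component[of T m]]
  show ?thesis by (simp add: o_def)
qed

lemma subshift_shift: "subshift S X \<Longrightarrow> x \<in> X \<Longrightarrow> shift v x \<in> X"
  by (auto simp: subshift_def)

lemma block_map_shift: "block_map S X T Y f \<Longrightarrow> x \<in> X \<Longrightarrow> f (shift v x) = shift v (f x)"
  by (auto simp: block_map_def)

text \<open>\<open>A\<close> is the window of a sliding block code. Comparing two configurations of
  \<open>X\<close> avoids assigning values to patterns that do not occur in
  \<open>X\<close>.\<close>

definition local_on :: "('g::ab_group_add) set \<Rightarrow> ('g \<Rightarrow> 'a) set \<Rightarrow> (('g \<Rightarrow> 'a) \<Rightarrow> 'g \<Rightarrow> 'b) \<Rightarrow> bool" where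
  "local_on A X f \<longleftrightarrow>
     (\<forall>x\<in>X. \<forall>y\<in>X. \<forall>v. (\<forall>m\<in>A. x (v + m) = y (v + m)) \<longrightarrow> f x v = f y v)"

lemma local_onD:
  assumes "local_on A X f" "x \<in> X" "y \<in> X" "\<And>m. m \<in> A \<Longrightarrow> x (v + m) = y (v + m)"
  shows "f x v = f y v"
  using assms unfolding local_on_def by blast

lemma local_on_mono: "local_on A X f \<Longrightarrow> A \<subseteq> B \<Longrightarrow> local_on B X f"
  unfolding local_on_def by (meson subsetD)

lemma local_onI:
  assumes "\<And>x v. x \<in> X \<Longrightarrow> shift v x \<in> X" "\<And>x v. x \<in> X \<Longrightarrow> f (shift v x) = shift v (f x)"
    and "\<And>x y. x \<in> X \<Longrightarrow> y \<in> X \<Longrightarrow> (\<And>m. m \<in> A \<Longrightarrow> x m = y m) \<Longrightarrow> f x 0 = f y 0"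
  shows "local_on A X f"
  unfolding local_on_def
proof (intro ballI allI impI)
  fix x y v assume "x \<in> X" "y \<in> X" "\<forall>m\<in>A. x (v + m) = y (v + m)"
  then have "f (shift v x) 0 = f (shift v y) 0"
    by (intro assms(3)) (auto simp: assms(1), auto simp: shift_def)
  then show "f x v = f y v"
    using assms(2)[of x v] assms(2)[of y v] \<open>x \<in> X\<close> \<open>y \<in> X\<close> by (simp add: shift_def)
qed

text \<open>Compactness gives a finite window at the origin, and shift equivariance carries it
  everywhere: this is the Curtis-Hedlund-Lyndon theorem.\<close>

lemma block_map_local:
  assumes "subshift S X" "block_map S X T Y f"
  obtains A where "finite A" "local_on A X f"
proof -
  have cl: "finite S" "closedin (full_shift S) X"
    using assms(1) by (auto simp: subshift_def)
  have "\<exists>A. finite A \<and> A \<subseteq> UNIV \<and>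
      (\<forall>x\<in>X. \<forall>y\<in>X. (\<forall>m\<in>A. x m = y m) \<longrightarrow> f x 0 = f y 0)"
  proof (rule compact_finite_determination[OF cl])
    show "f x 0 = f y 0" if "\<And>m. m \<in> UNIV \<Longrightarrow> x m = y m" for x y
    proof -
      have "x = y" using that by auto
      then show ?thesis by simp
    qed
  qed (rule continuous_map_from_subtopology[OF continuous_map_full_shift_component]
      block_map_component_continuous[OF assms(2)])+
  then obtain A where A: "finite A"
    "\<forall>x\<in>X. \<forall>y\<in>X. (\<forall>m\<in>A. x m = y m) \<longrightarrow> f x 0 = f y 0"
    by blast
  have "local_on A X f"
  proof (rule local_onI)
    show "f x 0 = f y 0" if "x \<in> X" "y \<in> X" "\<And>m. m \<in> A \<Longrightarrow> x m = y m" for x y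
      using A(2) that by blast
  qed (rule subshift_shift[OF assms(1)] block_map_shift[OF assms(2)], assumption)+
  then show thesis using that A(1) by blast
qed

text \<open>Continuity of the inverse is not presupposed. By injectivity all of \<open>f x\<close>
  determines the symbol \<open>x 0\<close>, so by compactness a finite part of \<open>f x\<close>
  does, and this is a window for \<open>g\<close>. The union of both windows serves \<open>f\<close>
  and \<open>g\<close> at once.\<close>

lemma conjugate_local_inverse:
  fixes X :: "('g::ab_group_add \<Rightarrow> 'a) set" and Y :: "('g \<Rightarrow> 'b) set"
  assumes "conjugate S X T Y"
  shows "\<exists>f g A. bij_betw f X Y \<and> finite A \<and> local_on A X f \<and> local_on A Y g \<and>
    (\<forall>x\<in>X. g (f x) = x) \<and> (\<forall>y\<in>Y. f (g y) = y) \<and> (\<forall>x\<in>X. f x \<in> Y) \<and> (\<forall>y\<in>Y. g y \<in> X) \<and>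
    (\<forall>x\<in>X. \<forall>v. f (shift v x) = shift v (f x)) \<and> (\<forall>y\<in>Y. \<forall>v. g (shift v y) = shift v (g y))"
proof -
  obtain f where subX: "subshift S X" and subY: "subshift T Y"
    and f: "block_map S X T Y f" and bij: "bij_betw f X Y"
    using assms by (auto simp: conjugate_def)
  obtain A where A: "finite A" "local_on A X f"
    using block_map_local[OF subX f] .
  define g where "g = inv_into X f"
  have gf: "g (f x) = x" if "x \<in> X" for x
    using bij that by (simp add: g_def bij_betw_inv_into_left)
  have fg: "f (g y) = y" if "y \<in> Y" for y
    using bij that by (simp add: g_def bij_betw_inv_into_right)
  have gX: "g y \<in> X" if "y \<in> Y" for y
    using bij that by (simp add: g_def bij_betw_def inv_into_into)
  have fY: "f x \<in> Y" if "x \<in> X" for x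
    using bij that by (auto simp: bij_betw_def)
  have fs: "f (shift v x) = shift v (f x)" if "x \<in> X" for x v
    using block_map_shift[OF f that] .
  have gs: "g (shift v y) = shift v (g y)" if "y \<in> Y" for y v
    using gf[of "shift v (g y)"] fs[of "g y" v] fg[OF that] gX[OF that] subshift_shift[OF subX] by auto
  have cl: "finite S" "closedin (full_shift S) X"
    using subX by (auto simp: subshift_def)
  have "\<exists>B. finite B \<and> B \<subseteq> UNIV \<and>
      (\<forall>x\<in>X. \<forall>y\<in>X. (\<forall>m\<in>B. f x m = f y m) \<longrightarrow> x 0 = y 0)"
  proof (rule compact_finite_determination[OF cl])
    show "x 0 = y 0" if "x \<in> X" "y \<in> X" "\<And>m. m \<in> UNIV \<Longrightarrow> f x m = f y m" for x y
    proof -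
      have "f x = f y" using that(3) by auto
      then show ?thesis using gf[OF that(1)] gf[OF that(2)] by metis
    qed
  qed (rule continuous_map_from_subtopology[OF continuous_map_full_shift_component]
      block_map_component_continuous[OF f])+
  then obtain B where B: "finite B"
    "\<forall>x\<in>X. \<forall>y\<in>X. (\<forall>m\<in>B. f x m = f y m) \<longrightarrow> x 0 = y 0"
    by blast
  have "local_on B Y g"
  proof (rule local_onI)
    show "g x 0 = g y 0" if "x \<in> Y" "y \<in> Y" "\<And>m. m \<in> B \<Longrightarrow> x m = y m" for x y
    proof -
      have "\<forall>m\<in>B. f (g x) m = f (g y) m"
        using that(3) fg[OF that(1)] fg[OF that(2)] by simp
      then show ?thesis using B(2) gX[OF that(1)] gX[OF that(2)] by blast
    qed
  qed (rule subshift_shift[OF subY] gs, assumption)+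
  then have gB: "local_on (A \<union> B) Y g" by (rule local_on_mono) simp
  have fA: "local_on (A \<union> B) X f" using A(2) by (rule local_on_mono) simp
  have "finite (A \<union> B)" using A(1) B(1) by simp
  then show ?thesis
    using bij fA gB gf fg fY gX fs gs by (intro exI[of _ f] exI[of _ g] exI[of _ "A \<union> B"] conjI ballI allI)
qed

section \<open>The subpattern order\<close>

text \<open>Restricting \<open>y\<close> to \<open>A\<close> gives a pattern of \<open>y\<close>;
  conversely, copying a translated domain of a pattern of \<open>y\<close> into \<open>x\<close>
  copies the occurrence. This form replaces patterns by translations from here on.\<close>

lemma subpattern_le_iff:
  "subpattern_le y x \<longleftrightarrow> (\<forall>A. finite A \<longrightarrow> (\<exists>v. \<forall>m\<in>A. x (v + m) = y m))"
proof
  assume le: "subpattern_le y x"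
  show "\<forall>A. finite A \<longrightarrow> (\<exists>v. \<forall>m\<in>A. x (v + m) = y m)"
  proof (intro allI impI)
    fix A :: "'a set" assume "finite A"
    define q where "q m = (if m \<in> A then Some (y m) else None)" for m
    have dom: "dom q = A" by (auto simp: q_def split: if_splits)
    have "q \<in> patterns_of y"
      unfolding patterns_of_def occurs_in_def using dom \<open>finite A\<close>
      by (auto simp: shift_def q_def intro!: exI[of _ 0])
    then have "q \<in> patterns_of x" using le by (auto simp: subpattern_le_def)
    then show "\<exists>v. \<forall>m\<in>A. x (v + m) = y m"
      using dom by (force simp: patterns_of_def occurs_in_def shift_def q_def)
  qed
next
  assume *: "\<forall>A. finite A \<longrightarrow> (\<exists>v. \<forall>m\<in>A. x (v + m) = y m)"
  show "subpattern_le y x"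
    unfolding subpattern_le_def
  proof
    fix q assume "q \<in> patterns_of y"
    then obtain n where q: "finite (dom q)" "\<forall>m\<in>dom q. q m = Some (y (n + m))"
      by (auto simp: patterns_of_def occurs_in_def shift_def)
    obtain v where "\<forall>m\<in>(+) n ` dom q. x (v + m) = y m"
      using * q(1) by (meson finite_imageI)
    then have "\<forall>m\<in>dom q. q m = Some (shift (v + n) x m)"
      using q(2) by (auto simp: shift_def add.assoc)
    then show "q \<in> patterns_of x"
      using q(1) by (auto simp: patterns_of_def occurs_in_def)
  qed
qed

lemma subpattern_le_trans: "subpattern_le x y \<Longrightarrow> subpattern_le y z \<Longrightarrow> subpattern_le x z"
  by (auto simp: subpattern_le_def)

lemma shift_shift: "shift u (shift v x) = shift (u + v) x"
  by (auto simp: shift_def add_ac)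

lemma shift_0 [simp]: "shift 0 x = x"
  by (simp add: shift_def)

lemma subpattern_le_shift_self: "subpattern_le (shift u x) x"
  unfolding subpattern_le_iff shift_def by blast

lemma subpattern_le_self_shift: "subpattern_le x (shift u x)"
  using subpattern_le_shift_self[of "- u" "shift u x"] by (simp add: shift_shift)

text \<open>The values of \<open>f y\<close> on \<open>B\<close> depend only on \<open>y\<close> on
  the finite set of sums of points of \<open>B\<close> and \<open>A\<close>, so a copy of
  \<open>y\<close> there produces a copy of \<open>f y\<close>.\<close>

lemma local_map_subpattern_le:
  assumes "finite A" "local_on A X f"
    and fs: "\<And>x v. x \<in> X \<Longrightarrow> f (shift v x) = shift v (f x)"
    and Xs: "\<And>x v. x \<in> X \<Longrightarrow> shift v x \<in> X"
    and "x \<in> X" "y \<in> X" "subpattern_le y x"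
  shows "subpattern_le (f y) (f x)"
  unfolding subpattern_le_iff
proof (intro allI impI)
  fix B :: "'a set" assume "finite B"
  then have "finite ((\<lambda>(b, a). b + a) ` (B \<times> A))"
    using assms(1) by blast
  then obtain v where v: "\<forall>m\<in>(\<lambda>(b, a). b + a) ` (B \<times> A). x (v + m) = y m"
    using assms(7) unfolding subpattern_le_iff by blast
  have "f (shift v x) b = f y b" if "b \<in> B" for b
    using that v assms by (intro local_onD[OF assms(2)]) (auto simp: shift_def)
  then show "\<exists>v. \<forall>m\<in>B. f x (v + m) = f y m"
    using fs[OF assms(5)] by (auto simp: shift_def intro!: exI[of _ v])
qed

section \<open>Gluing and loops in countable subshifts\<close>

definition glue :: "('g \<Rightarrow> int) \<Rightarrow> ('g \<Rightarrow> 'a) \<Rightarrow> ('g \<Rightarrow> 'a) \<Rightarrow> 'g \<Rightarrow> 'a" where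
  "glue \<phi> x y = (\<lambda>m. if 0 \<le> \<phi> m then x m else y m)"

text \<open>A Markov property with memory \<open>r\<close> across the level set of the height
  \<open>\<phi>\<close>. The height is \<open>snd\<close> in the plane and the identity on the line,
  which lets one argument treat both dimensions.\<close>

definition glueable :: "('g \<Rightarrow> int) \<Rightarrow> int \<Rightarrow> ('g \<Rightarrow> 'a) set \<Rightarrow> bool" where
  "glueable \<phi> r X \<longleftrightarrow>
     (\<forall>x\<in>X. \<forall>y\<in>X. (\<forall>m. 0 \<le> \<phi> m \<and> \<phi> m < r \<longrightarrow> x m = y m) \<longrightarrow> glue \<phi> x y \<in> X)"

lemma finite_int_bound:
  assumes "finite A"
  obtains R :: int where "0 \<le> R" "\<And>a. a \<in> A \<Longrightarrow> \<bar>\<phi> a\<bar> \<le> R"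
proof -
  have "\<bar>\<phi> a\<bar> \<le> (\<Sum>a\<in>A. \<bar>\<phi> a\<bar>)" if "a \<in> A" for a
    using assms that by (intro member_le_sum) auto
  then show thesis by (intro that[of "\<Sum>a\<in>A. \<bar>\<phi> a\<bar>"]) (auto intro: sum_nonneg)
qed

text \<open>If forbidden patterns have heights between \<open>- R\<close> and \<open>R\<close>, an
  overlap of \<open>2 * R + 1\<close> levels forces each occurrence in the glued configuration to
  lie in a region where it coincides with one of the two pieces.\<close>

lemma sft_glueable:
  fixes X :: "('g::ab_group_add \<Rightarrow> 'a) set"
  assumes "sft S X" and add: "\<And>a b. \<phi> (a + b) = \<phi> a + \<phi> b"
  obtains r where "0 < r" "glueable \<phi> r X"
proof -
  obtain F where F: "finite F" "\<And>q. q \<in> F \<Longrightarrow> finite (dom q)"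
    and X: "X = {x \<in> topspace (full_shift S). \<forall>q\<in>F. \<not> occurs_in q x}"
    using assms(1) unfolding sft_def by blast
  obtain R where R: "0 \<le> R" "\<And>m. m \<in> (\<Union>q\<in>F. dom q) \<Longrightarrow> \<bar>\<phi> m\<bar> \<le> R"
    using finite_int_bound[of "\<Union>q\<in>F. dom q" \<phi>] F by blast
  have "glue \<phi> x y \<in> X"
    if xy: "x \<in> X" "y \<in> X" and eq: "\<forall>m. 0 \<le> \<phi> m \<and> \<phi> m < 2 * R + 1 \<longrightarrow> x m = y m" for x y
  proof -
    have "glue \<phi> x y \<in> topspace (full_shift S)"
      using xy by (auto simp: X topspace_full_shift glue_def)
    moreover have False if q: "q \<in> F" "occurs_in q (glue \<phi> x y)" for q
    proof -
      obtain n where n: "\<forall>m\<in>dom q. q m = Some (glue \<phi> x y (n + m))"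
        using q(2) by (auto simp: occurs_in_def shift_def)
      have R': "\<bar>\<phi> m\<bar> \<le> R" if "m \<in> dom q" for m
        using R(2) q(1) that by blast
      \<comment> \<open>An anchor at level at least \<open>R\<close> keeps the pattern at
        nonnegative levels. A lower anchor keeps it below \<open>2 * R\<close>, where
        \<open>y\<close> equals the glued configuration thanks to the overlap.\<close>
      have "occurs_in q x \<or> occurs_in q y"
      proof (cases "R \<le> \<phi> n")
        case True
        have "glue \<phi> x y (n + m) = x (n + m)" if "m \<in> dom q" for m
          using R'[OF that] True by (auto simp: glue_def add)
        then have "occurs_in q x" using n by (auto simp: occurs_in_def shift_def intro!: exI[of _ n])
        then show ?thesis ..
      next
        case False
        have "glue \<phi> x y (n + m) = y (n + m)" if "m \<in> dom q" for m
          using R'[OF that] False eq by (auto simp: glue_def add)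
        then have "occurs_in q y" using n by (auto simp: occurs_in_def shift_def intro!: exI[of _ n])
        then show ?thesis ..
      qed
      then show False using xy q(1) by (auto simp: X)
    qed
    ultimately show ?thesis by (auto simp: X)
  qed
  then show thesis
    using R(1) by (intro that[of "2 * R + 1"]) (auto simp: glueable_def)
qed

lemma glueable_at:
  fixes X :: "(int \<times> int \<Rightarrow> 'a) set"
  assumes glue: "glueable snd r X" and shift_closed: "\<forall>x\<in>X. \<forall>v. shift v x \<in> X"
    and "x \<in> X" "y \<in> X" "\<And>m. h \<le> snd m \<Longrightarrow> snd m < h + r \<Longrightarrow> x m = y m"
  shows "(\<lambda>m. if h \<le> snd m then x m else y m) \<in> X"
proof -
  have "shift (0, h) x \<in> X" "shift (0, h) y \<in> X"
    using shift_closed assms(3,4) by blast+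
  then have "glue snd (shift (0, h) x) (shift (0, h) y) \<in> X"
    using glue assms(5) by (auto simp: glueable_def shift_def)
  then have "shift (0, -h) (glue snd (shift (0, h) x) (shift (0, h) y)) \<in> X"
    using shift_closed by blast
  moreover have "shift (0, -h) (glue snd (shift (0, h) x) (shift (0, h) y))
      = (\<lambda>m. if h \<le> snd m then x m else y m)"
    by (auto simp: shift_def glue_def fun_eq_iff)
  ultimately show ?thesis by simp
qed

text \<open>Cantor's diagonal argument: \<open>d\<close> differs at \<open>n\<close> from the
  sequence decoded from the \<open>n\<close>-th element of the enumeration of
  \<open>X\<close>.\<close>

lemma no_injection_of_bool_sequences:
  fixes Z :: "(nat \<Rightarrow> bool) \<Rightarrow> 'a"
  assumes "countable X" "\<And>e. Z e \<in> X"
  shows "\<not> inj Z"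
proof
  assume "inj Z"
  define d where "d n = (\<not> inv Z (from_nat_into X n) n)" for n
  obtain n where "from_nat_into X n = Z d"
    using assms from_nat_into_surj by metis
  then have "inv Z (from_nat_into X n) = d"
    using \<open>inj Z\<close> by simp
  then show False using d_def[of n] by simp
qed

text \<open>These consequences of being a countable SFT suffice for the loop arguments. They
  transfer to a conjugate subshift, and to one-dimensional configurations viewed as constant in the
  first coordinate, without constructing forbidden patterns.\<close>

locale countable_glueable =
  fixes X :: "(int \<times> int \<Rightarrow> 'a) set" and r :: int
  assumes countable: "countable X"
    and shift_closed: "x \<in> X \<Longrightarrow> shift v x \<in> X"
    and limit_closed: "(\<And>A. finite A \<Longrightarrow> \<exists>x\<in>X. \<forall>m\<in>A. x m = z m) \<Longrightarrow> z \<in> X"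
    and glueable: "glueable snd r X"
begin

lemma glue_at:
  assumes "x \<in> X" "y \<in> X" "\<And>m. h \<le> snd m \<Longrightarrow> snd m < h + r \<Longrightarrow> x m = y m"
  shows "(\<lambda>m. if h \<le> snd m then x m else y m) \<in> X"
  by (rule glueable_at[OF glueable _ assms]) (simp_all add: shift_closed)

text \<open>Two distinct slabs with the same boundary rows could be stacked in any order, which would
  give uncountably many configurations.\<close>

lemma slabs_agree:
  assumes w: "\<And>e::bool. w e \<in> X"
    and agree: "\<And>m. 0 \<le> snd m \<Longrightarrow> snd m < r \<Longrightarrow> w True m = w False m"
    and loop: "\<And>e m. 0 \<le> snd m \<Longrightarrow> snd m < r \<Longrightarrow> w e (c + m) = w e m"
    and c: "0 < snd c" and m: "0 \<le> snd m" "snd m < snd c"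
  shows "w True m = w False m"
proof (rule ccontr)
  assume neq: "w True m \<noteq> w False m"
  define lev where "lev v = snd v div snd c" for v :: "int \<times> int"
  define mul where "mul k = (k * fst c, k * snd c)" for k :: int
  \<comment> \<open>Slab number \<open>k\<close> of the stack is a copy of the slab of
    \<open>w (\<epsilon> k)\<close>, moved by \<open>k\<close> times \<open>c\<close>; everything
    below height 0 comes from \<open>w False\<close>.\<close>
  define Z where "Z \<epsilon> v = (if snd v < 0 then w False v else w (\<epsilon> (nat (lev v))) (v - mul (lev v)))"
    for \<epsilon> :: "nat \<Rightarrow> bool" and v
  \<comment> \<open>The finite stage continues with \<open>w (\<epsilon> n)\<close> above slab
    \<open>n\<close>, so each new slab needs just one more gluing.\<close>
  define Zn where "Zn \<epsilon> n v = (if snd v < int n * snd c then Z \<epsilon> v else w (\<epsilon> n) (v - mul (int n)))"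
    for \<epsilon> :: "nat \<Rightarrow> bool" and n v
  have agree': "w e v = w e' v" if "0 \<le> snd v" "snd v < r" for e e' v
    using agree[OF that] by (cases e; cases e') auto
  have lev_eq: "lev v = int n" if "int n * snd c \<le> snd v" "snd v < int (Suc n) * snd c" for n v
    unfolding lev_def using that
    by (intro int_div_pos_eq[of _ _ _ "snd v - int n * snd c"]) (auto simp: algebra_simps)
  have shift_back: "(\<lambda>v. w e (v - mul k)) \<in> X" for e k
    using shift_closed[OF w, of "- mul k" e] by (simp add: shift_def algebra_simps)
  have mul_Suc: "v - mul (int n) = c + (v - mul (int (Suc n)))" for v n
    by (cases v) (auto simp: mul_def algebra_simps prod_eq_iff)
  have Zn: "Zn \<epsilon> n \<in> X" for \<epsilon> n
  proof (induction n)
    case 0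
    have "(\<lambda>v. if 0 \<le> snd v then w (\<epsilon> 0) v else w False v) \<in> X"
      by (rule glue_at) (auto intro: w agree')
    moreover have "Zn \<epsilon> 0 = (\<lambda>v. if 0 \<le> snd v then w (\<epsilon> 0) v else w False v)"
      by (auto simp: Zn_def Z_def mul_def fun_eq_iff zero_prod_def[symmetric])
    ultimately show ?case by simp
  next
    case (Suc n)
    let ?h = "int (Suc n) * snd c"
    have "(\<lambda>v. if ?h \<le> snd v then w (\<epsilon> (Suc n)) (v - mul (int (Suc n))) else Zn \<epsilon> n v) \<in> X"
    proof (rule glue_at[OF shift_back Suc])
      fix v :: "int \<times> int" assume v: "?h \<le> snd v" "snd v < ?h + r"
      let ?u = "v - mul (int (Suc n))"
      have u: "0 \<le> snd ?u" "snd ?u < r" using v by (auto simp: mul_def)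
      have "Zn \<epsilon> n v = w (\<epsilon> n) (v - mul (int n))"
        using v c by (auto simp: Zn_def algebra_simps)
      also have "\<dots> = w (\<epsilon> n) (c + ?u)" by (rule arg_cong[OF mul_Suc])
      also have "\<dots> = w (\<epsilon> n) ?u" using u by (rule loop)
      also have "\<dots> = w (\<epsilon> (Suc n)) ?u" using u by (rule agree')
      finally show "w (\<epsilon> (Suc n)) ?u = Zn \<epsilon> n v" ..
    qed
    moreover have "(\<lambda>v. if ?h \<le> snd v then w (\<epsilon> (Suc n)) (v - mul (int (Suc n))) else Zn \<epsilon> n v)
        = Zn \<epsilon> (Suc n)"
    proof
      fix v :: "int \<times> int"
      show "(if ?h \<le> snd v then w (\<epsilon> (Suc n)) (v - mul (int (Suc n))) else Zn \<epsilon> n v) = Zn \<epsilon> (Suc n) v"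
      proof (cases "int n * snd c \<le> snd v \<and> snd v < ?h")
        case True
        then have l: "lev v = int n" by (intro lev_eq) auto
        have "0 \<le> snd v" using True c by (meson order_trans mult_nonneg_nonneg of_nat_0_le_iff less_imp_le)
        with True l show ?thesis by (auto simp: Zn_def Z_def)
      next
        case False
        with c show ?thesis by (auto simp: Zn_def algebra_simps)
      qed
    qed
    ultimately show ?case by simp
  qed
  have "Z \<epsilon> \<in> X" for \<epsilon>
  proof (rule limit_closed)
    fix A :: "(int \<times> int) set" assume "finite A"
    then obtain R where R: "0 \<le> R" "\<And>v. v \<in> A \<Longrightarrow> \<bar>snd v\<bar> \<le> R"
      by (rule finite_int_bound[where \<phi> = snd]) blast
    have "R < int (nat R + 1) * snd c"
      using R(1) c mult_left_mono[of 1 "snd c" "R + 1"] by (simp add: algebra_simps)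
    then have "\<forall>v\<in>A. Zn \<epsilon> (nat R + 1) v = Z \<epsilon> v"
      using R(2) by (fastforce simp: Zn_def)
    then show "\<exists>x\<in>X. \<forall>v\<in>A. x v = Z \<epsilon> v" using Zn by blast
  qed
  \<comment> \<open>The translate of the disagreement point \<open>m\<close> in slab
    \<open>n\<close> reveals \<open>\<epsilon> n\<close>.\<close>
  moreover have "inj Z"
  proof (rule injI, rule ext)
    fix \<epsilon> \<epsilon>' n assume "Z \<epsilon> = Z \<epsilon>'"
    then have eq: "Z \<epsilon> (m + mul (int n)) = Z \<epsilon>' (m + mul (int n))" by simp
    have l: "lev (m + mul (int n)) = int n"
      using m c by (intro lev_eq) (auto simp: mul_def algebra_simps)
    have "0 \<le> snd (m + mul (int n))" using m c by (simp add: mul_def)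
    then have "w (\<epsilon> n) m = w (\<epsilon>' n) m" using eq l by (simp add: Z_def)
    then show "\<epsilon> n = \<epsilon>' n" using neq by (cases "\<epsilon> n"; cases "\<epsilon>' n") auto
  qed
  ultimately show False
    using no_injection_of_bool_sequences[OF countable] by blast
qed

text \<open>The period comes from comparing the slab \<open>x\<close> followed by \<open>y\<close> with \<open>y\<close> followed by \<open>x\<close>.\<close>

lemma loops_commute:
  assumes x: "x \<in> X" and y: "y \<in> X"
    and agree: "\<And>m. 0 \<le> snd m \<Longrightarrow> snd m < r \<Longrightarrow> x m = y m"
    and loop_x: "\<And>m. 0 \<le> snd m \<Longrightarrow> snd m < r \<Longrightarrow> x (c + m) = x m"
    and loop_y: "\<And>m. 0 \<le> snd m \<Longrightarrow> snd m < r \<Longrightarrow> y (d + m) = y m"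
    and c: "0 < snd c" and d: "0 < snd d"
    and m: "0 \<le> snd m" "snd (c + m) < snd d + r"
  shows "y (c + m) = y m"
proof -
  have yc: "(\<lambda>v. y (v - c)) \<in> X" and xd: "(\<lambda>v. x (v - d)) \<in> X"
    using shift_closed[OF y, of "- c"] shift_closed[OF x, of "- d"]
    by (simp_all add: shift_def algebra_simps)
  \<comment> \<open>The two orders of stacking: \<open>w True\<close> is the slab of
    \<open>x\<close> followed by \<open>y\<close>, \<open>w False\<close> the slab of
    \<open>y\<close> followed by \<open>x\<close>. Both have the same boundary rows and return after
    \<open>c + d\<close>.\<close>
  define w where "w e = (if e then (\<lambda>v. if snd c \<le> snd v then y (v - c) else x v)
      else (\<lambda>v. if snd d \<le> snd v then x (v - d) else y v))" for e
  have seam_x: "y (v - c) = x v" if "snd c \<le> snd v" "snd v < snd c + r" for v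
    using agree[of "v - c"] loop_x[of "v - c"] that by simp
  have seam_y: "x (v - d) = y v" if "snd d \<le> snd v" "snd v < snd d + r" for v
    using agree[of "v - d"] loop_y[of "v - d"] that by simp
  have wX: "w e \<in> X" for e
    using glue_at[OF yc x seam_x, of "snd c"] glue_at[OF xd y seam_y, of "snd d"]
    by (cases e) (simp_all add: w_def)
  have wx: "w True v = x v" if "snd v < snd c + r" for v
    using seam_x that by (auto simp: w_def)
  have wy: "w False v = y v" if "snd v < snd d + r" for v
    using seam_y that by (auto simp: w_def)
  have bd: "w True v = w False v" if "0 \<le> snd v" "snd v < r" for v
    using that c d agree by (simp add: wx wy)
  have lp: "w e (c + d + v) = w e v" if v: "0 \<le> snd v" "snd v < r" for e v
  proof (cases e)
    case True
    have "w True (c + d + v) = y (d + v)" using v c d by (simp add: w_def algebra_simps)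
    then show ?thesis using v c True by (simp add: loop_y agree wx)
  next
    case False
    have "w False (c + d + v) = x (c + v)" using v c d by (simp add: w_def algebra_simps)
    then show ?thesis using v d False by (simp add: loop_x agree wy)
  qed
  have slab: "w True v = w False v" if "0 \<le> snd v" "snd v < snd (c + d)" for v
    by (rule slabs_agree[OF wX bd lp _ that]) (use c d in simp_all)
  \<comment> \<open>Points beyond the combined slab lie in its closing boundary rows, which the loop
    \<open>c + d\<close> brings back to the bottom. At \<open>c + m\<close>, \<open>w True\<close>
    reads \<open>y m\<close> and \<open>w False\<close> reads \<open>y (c + m)\<close>.\<close>
  have "w True (c + m) = w False (c + m)"
  proof (cases "snd m < snd d")
    case True
    then show ?thesis using m c by (intro slab) auto
  next
    case False
    let ?v = "m - d"
    have v: "0 \<le> snd ?v" "snd ?v < r" using False m c by auto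
    have "c + m = c + d + ?v" by simp
    then show ?thesis using lp[OF v] bd[OF v] by metis
  qed
  moreover have "w True (c + m) = y m" using m by (simp add: w_def)
  moreover have "w False (c + m) = y (c + m)" using m by (intro wy)
  ultimately show ?thesis by simp
qed

end

section \<open>Countable one-dimensional SFTs are almost periodic\<close>

text \<open>Configurations on the line become planar ones that ignore the first coordinate, and
  commutation of planar loops applies with vertical vectors. The returns of \<open>y\<close> at
  \<open>i\<close> and \<open>j\<close> supply the period, those of \<open>y'\<close> the interval
  on which it holds.\<close>

lemma countable_sft_loops:
  fixes Y :: "(int \<Rightarrow> 'a) set"
  assumes "sft U Y" "countable Y"
  obtains w where "0 < w"
    "\<And>y y' i j i' j' k. y \<in> Y \<Longrightarrow> y' \<in> Y \<Longrightarrow> i < j \<Longrightarrow> i' < j' \<Longrightarrow>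
      (\<And>l. 0 \<le> l \<Longrightarrow> l < w \<Longrightarrow> y (i + l) = y' (i' + l)) \<Longrightarrow>
      (\<And>l. 0 \<le> l \<Longrightarrow> l < w \<Longrightarrow> y (j + l) = y (i + l)) \<Longrightarrow>
      (\<And>l. 0 \<le> l \<Longrightarrow> l < w \<Longrightarrow> y' (j' + l) = y' (i' + l)) \<Longrightarrow>
      i' \<le> k \<Longrightarrow> k + (j - i) < j' + w \<Longrightarrow> y' (k + (j - i)) = y' k"
proof -
  obtain w where w: "0 < w" "glueable (\<lambda>j. j) w Y"
    using sft_glueable[OF assms(1), of "\<lambda>j. j"] by auto
  have sub: "subshift U Y" using assms(1) by (simp add: sft_def)
  let ?X = "(\<lambda>y m. y (snd m)) ` Y :: (int \<times> int \<Rightarrow> 'a) set"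
  interpret countable_glueable ?X w
  proof
    show "countable ?X" using assms(2) by simp
    show "shift v x \<in> ?X" if "x \<in> ?X" for x v
    proof -
      obtain y where y: "y \<in> Y" "x = (\<lambda>m. y (snd m))" using \<open>x \<in> ?X\<close> by auto
      have "shift (snd v) y \<in> Y" using subshift_shift[OF sub y(1)] .
      moreover have "shift v x = (\<lambda>m. shift (snd v) y (snd m))"
        by (simp add: shift_def y(2))
      ultimately show ?thesis by blast
    qed
    show "z \<in> ?X" if lim: "\<And>A. finite A \<Longrightarrow> \<exists>x\<in>?X. \<forall>m\<in>A. x m = z m" for z
    proof -
      define y where "y j = z (0, j)" for j
      have "z m = y (snd m)" for m
      proof -
        have "\<exists>x\<in>?X. \<forall>n\<in>{m, (0, snd m)}. x n = z n" by (rule lim) simp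
        then show ?thesis by (auto simp: y_def)
      qed
      moreover have "y \<in> Y"
      proof (rule closedin_full_shift_limit)
        show "closedin (full_shift U) Y" using sub by (simp add: subshift_def)
        show "\<exists>x\<in>Y. \<forall>j\<in>A. x j = y j" if "finite A" for A
        proof -
          have "\<exists>x\<in>?X. \<forall>n\<in>Pair 0 ` A. x n = z n" using that by (intro lim) simp
          then show ?thesis by (auto simp: y_def)
        qed
      qed
      ultimately show ?thesis by (intro image_eqI[of _ _ y]) auto
    qed
    show "glueable snd w ?X"
      unfolding glueable_def
    proof (intro ballI impI)
      fix x x' assume "x \<in> ?X" "x' \<in> ?X" and eq: "\<forall>m. 0 \<le> snd m \<and> snd m < w \<longrightarrow> x m = x' m"
      then obtain y y' where y: "y \<in> Y" "x = (\<lambda>m. y (snd m))" "y' \<in> Y" "x' = (\<lambda>m. y' (snd m))"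
        by auto
      then have "glue (\<lambda>j. j) y y' \<in> Y" using w(2) eq by (auto simp: glueable_def)
      moreover have "glue snd x x' = (\<lambda>m. glue (\<lambda>j. j) y y' (snd m))"
        by (auto simp: glue_def y)
      ultimately show "glue snd x x' \<in> ?X" by blast
    qed
  qed
  show thesis
  proof (rule that[OF w(1)])
    fix y y' :: "int \<Rightarrow> 'a" and i j i' j' k :: int
    assume y: "y \<in> Y" "y' \<in> Y" and ij: "i < j" "i' < j'"
      and eq: "\<And>l. 0 \<le> l \<Longrightarrow> l < w \<Longrightarrow> y (i + l) = y' (i' + l)"
        "\<And>l. 0 \<le> l \<Longrightarrow> l < w \<Longrightarrow> y (j + l) = y (i + l)"
        "\<And>l. 0 \<le> l \<Longrightarrow> l < w \<Longrightarrow> y' (j' + l) = y' (i' + l)"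
      and k: "i' \<le> k" "k + (j - i) < j' + w"
    define x where "x m = y (i + snd m)" for m :: "int \<times> int"
    define x' where "x' m = y' (i' + snd m)" for m :: "int \<times> int"
    have "x \<in> ?X" "x' \<in> ?X"
      by (rule image_eqI[OF _ subshift_shift[OF sub y(1), of i]] image_eqI[OF _ subshift_shift[OF sub y(2), of i']],
        simp add: x_def x'_def shift_def fun_eq_iff)+
    then have "x' ((0, j - i) + (0, k - i')) = x' (0, k - i')"
      by (rule loops_commute[where d = "(0, j' - i')"]) (use ij k eq in \<open>auto simp: x_def x'_def algebra_simps\<close>)
    then show "y' (k + (j - i)) = y' k" by (simp add: x'_def algebra_simps)
  qed
qed

lemma iterated_period:
  fixes y :: "int \<Rightarrow> 'a"
  assumes per: "\<And>k. i \<le> k \<Longrightarrow> k + q < j \<Longrightarrow> y (k + q) = y k"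
    and "0 < q" "i \<le> k" "k + int n * q < j"
  shows "y (k + int n * q) = y k"
  using assms(4)
proof (induction n)
  case (Suc n)
  have "0 \<le> int n * q" using assms(2) by simp
  moreover have lt: "k + int n * q + q < j" using Suc.prems by (simp add: algebra_simps)
  ultimately have "y (k + int n * q + q) = y (k + int n * q)"
    using assms(3) by (intro per) linarith+
  moreover have "y (k + int n * q) = y k" using lt assms(2) by (intro Suc.IH) linarith
  ultimately show ?case by (simp add: algebra_simps)
qed simp

lemma card_le_of_diameter:
  fixes A :: "int set"
  assumes "\<And>a b. a \<in> A \<Longrightarrow> b \<in> A \<Longrightarrow> b - a < p"
  shows "finite A \<and> card A \<le> nat (2 * p)"
proof (cases "A = {}")
  case False
  then obtain a where a: "a \<in> A" by blast
  have "A \<subseteq> {a - p..<a + p}" using assms[OF a] assms[OF _ a] by force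
  then show ?thesis using card_mono[of "{a - p..<a + p}" A] finite_subset[of A "{a - p..<a + p}"] by simp
qed simp

text \<open>Any two returns to the same word of window length \<open>w\<close> are periodic with one period depending
  only on the word, so a word can start at most boundedly many defects of the common period \<open>p\<close>.\<close>

lemma countable_sft_almost_periodic:
  fixes Y :: "(int \<Rightarrow> 'a) set"
  assumes "sft U Y" "countable Y"
  shows "\<exists>p>0. \<exists>K. \<forall>y\<in>Y. finite {k. y k \<noteq> y (k + p)} \<and> card {k. y k \<noteq> y (k + p)} \<le> K"
proof (rule countable_sft_loops[OF assms], goal_cases)
  case (1 w)
  note w = 1(1) and loops = 1(2)
  have sub: "subshift U Y" using assms(1) by (simp add: sft_def)
  have Y: "y k \<in> U" if "y \<in> Y" for y k
  proof -
    have "y \<in> topspace (full_shift U)"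
      using sub that closedin_subset unfolding subshift_def by blast
    then show ?thesis by (simp add: topspace_full_shift)
  qed
  define word where "word y i = map (\<lambda>l. y (i + int l)) [0..<nat w]" for y :: "int \<Rightarrow> 'a" and i
  define W where "W = {u. set u \<subseteq> U \<and> length u = nat w}"
  have "finite W" using sub by (simp add: W_def finite_lists_length_eq subshift_def)
  have word_W: "word y i \<in> W" if "y \<in> Y" for y i
    using Y[OF that] by (auto simp: W_def word_def)
  have wordD: "y (i + l) = y' (i' + l)" if "word y i = word y' i'" "0 \<le> l" "l < w" for y y' i i' l
  proof -
    have "word y i ! nat l = word y' i' ! nat l" using that(1) by simp
    then show ?thesis using that(2,3) by (simp add: word_def)
  qed
  \<comment> \<open>The gap of one chosen return to \<open>u\<close> serves for all configurations,
    because loops at \<open>u\<close> commute.\<close>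
  have "\<exists>q>0. \<forall>y\<in>Y. \<forall>i j k. i < j \<longrightarrow> word y i = u \<longrightarrow> word y j = u \<longrightarrow>
      i \<le> k \<longrightarrow> k + q < j + w \<longrightarrow> y (k + q) = y k" for u
  proof (cases "\<exists>y\<in>Y. \<exists>i j. i < j \<and> word y i = u \<and> word y j = u")
    case True
    then obtain y i j where y: "y \<in> Y" "i < j" "word y i = u" "word y j = u" by blast
    show ?thesis
    proof (intro exI[of _ "j - i"] conjI ballI allI impI)
      fix y' i' j' k assume *: "y' \<in> Y" "i' < j'" "word y' i' = u" "word y' j' = u"
        "i' \<le> k" "k + (j - i) < j' + w"
      show "y' (k + (j - i)) = y' k"
        by (rule loops[OF y(1) *(1) y(2) *(2) _ _ _ *(5,6)]; rule wordD) (simp_all add: y *)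
    qed (use y(2) in simp)
  next
    case False
    \<comment> \<open>No configuration returns to \<open>u\<close>, so the value 1 is an arbitrary
      positive default.\<close>
    then show ?thesis by (intro exI[of _ 1]) auto
  qed
  then obtain q where q: "\<And>u. 0 < q u" and per: "\<And>u y i j k. y \<in> Y \<Longrightarrow> i < j \<Longrightarrow> word y i = u \<Longrightarrow>
      word y j = u \<Longrightarrow> i \<le> k \<Longrightarrow> k + q u < j + w \<Longrightarrow> y (k + q u) = y k"
    by metis
  \<comment> \<open>The product is a common multiple of the periods attached to the finitely many
    words.\<close>
  define p where "p = (\<Prod>u\<in>W. q u)"
  have "0 < p" unfolding p_def using q by (intro prod_pos) auto
  have "\<forall>y\<in>Y. finite {k. y k \<noteq> y (k + p)} \<and> card {k. y k \<noteq> y (k + p)} \<le> card W * nat (2 * p)"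
  proof
    fix y assume y: "y \<in> Y"
    define D where "D u = {k. y k \<noteq> y (k + p) \<and> word y k = u}" for u
    have D: "finite (D u) \<and> card (D u) \<le> nat (2 * p)" if u: "u \<in> W" for u
    proof (rule card_le_of_diameter, rule ccontr)
      fix a b assume ab: "a \<in> D u" "b \<in> D u" "\<not> b - a < p"
      have "q u dvd p" unfolding p_def using \<open>finite W\<close> u by (rule dvd_prodI)
      then obtain t where t: "p = q u * t" ..
      have "0 < t" using \<open>0 < p\<close> q[of u] t by (simp add: zero_less_mult_iff)
      \<comment> \<open>The word \<open>u\<close> stands at both \<open>a\<close> and
        \<open>b\<close>, so \<open>q u\<close> is a period up to \<open>b + w\<close>. Since
        \<open>a + p\<close> does not exceed \<open>b\<close>, the position \<open>a\<close> cannot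
        be a defect.\<close>
      have "y (a + int (nat t) * q u) = y a"
      proof (rule iterated_period[where i = a and j = "b + w"])
        show "y (k + q u) = y k" if "a \<le> k" "k + q u < b + w" for k
          using ab \<open>0 < p\<close> that by (intro per[OF y, of a b]) (auto simp: D_def)
      qed (use q \<open>0 < t\<close> t ab w in \<open>auto simp: mult.commute\<close>)
      then show False using ab(1) \<open>0 < t\<close> t by (simp add: D_def mult.commute)
    qed
    have U: "{k. y k \<noteq> y (k + p)} = (\<Union>u\<in>W. D u)"
      using word_W[OF y] by (auto simp: D_def)
    have "card (\<Union>u\<in>W. D u) \<le> (\<Sum>u\<in>W. card (D u))"
      using \<open>finite W\<close> by (rule card_UN_le)
    also have "\<dots> \<le> card W * nat (2 * p)"
      using sum_bounded_above[of W "\<lambda>u. card (D u)" "nat (2 * p)"] D by simp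
    finally show "finite {k. y k \<noteq> y (k + p)} \<and> card {k. y k \<noteq> y (k + p)} \<le> card W * nat (2 * p)"
      using U D \<open>finite W\<close> by simp
  qed
  then show ?thesis using \<open>0 < p\<close> by blast
qed

section \<open>Defects and the subpattern order\<close>

lemma period_multiple:
  fixes x :: "int \<times> int \<Rightarrow> 'a"
  assumes "\<And>m. x (c + m) = x m"
  shows "x ((k * fst c, k * snd c) + m) = x m"
proof -
  have nat: "x ((int n * fst c, int n * snd c) + m) = x m" for n m
  proof (induction n arbitrary: m)
    case (Suc n)
    have "(int (Suc n) * fst c, int (Suc n) * snd c) + m = c + ((int n * fst c, int n * snd c) + m)"
      by (simp add: prod_eq_iff algebra_simps)
    then show ?case using assms Suc by metis
  qed (simp flip: zero_prod_def)
  show ?thesis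
  proof (cases "0 \<le> k")
    case True
    then show ?thesis using nat[of "nat k" m] by simp
  next
    case False
    have inv: "(int (nat (- k)) * fst c, int (nat (- k)) * snd c) + ((k * fst c, k * snd c) + m) = m"
      using False by (simp add: prod_eq_iff)
    show ?thesis
      using nat[of "nat (- k)" "(k * fst c, k * snd c) + m"] unfolding inv by (rule sym)
  qed
qed

text \<open>If every \<open>v\<close> in \<open>V\<close> failed at some point, the finite set of
  these points would defeat all of them at once.\<close>

lemma finite_directed_choice:
  assumes "finite V" and ex: "\<And>A. finite A \<Longrightarrow> \<exists>v\<in>V. \<forall>m\<in>A. P v m"
  shows "\<exists>v\<in>V. \<forall>m. P v m"
proof (rule ccontr)
  assume "\<not> ?thesis"
  then obtain f where f: "\<And>v. v \<in> V \<Longrightarrow> \<not> P v (f v)" by metis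
  have "finite (f ` V)" using assms(1) by simp
  from ex[OF this] f show False by blast
qed

text \<open>Only the block of rows \<open>0\<close> to \<open>r - 1\<close> is inspected; other
  blocks are reached by translating \<open>x\<close>. Each row is infinite, so finiteness is a
  genuine condition.\<close>

definition defects :: "int \<Rightarrow> int \<Rightarrow> (int \<times> int \<Rightarrow> 'a) \<Rightarrow> (int \<times> int) set" where
  "defects r p x = {m. 0 \<le> snd m \<and> snd m < r \<and> x m \<noteq> x (m + (p, 0))}"

text \<open>Common ground of the countable and the deterministic case. They differ only in what
  follows when an \<open>r\<close>-row block of \<open>y\<close> recurs in \<open>x\<close>
  arbitrarily high or arbitrarily low; a resulting period is required only on a half-plane.\<close>

locale bounded_defects =
  fixes X :: "(int \<times> int \<Rightarrow> 'a) set" and r p :: int and K :: nat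
  assumes r: "0 < r" and p: "0 < p"
    and shift_closed: "x \<in> X \<Longrightarrow> shift v x \<in> X"
    and defects: "x \<in> X \<Longrightarrow> finite (defects r p x) \<and> card (defects r p x) \<le> K"
    and returns_above: "\<lbrakk>x \<in> X; y \<in> X;
      \<And>h. \<exists>v. h < snd v \<and> (\<forall>m. 0 \<le> snd m \<and> snd m < r \<longrightarrow> x (v + m) = y m)\<rbrakk> \<Longrightarrow>
      subpattern_le x y \<or> (\<exists>c h. snd c \<noteq> 0 \<and> (\<forall>m. h \<le> snd m \<longrightarrow> x (c + m) = x m))"
    and returns_below: "\<lbrakk>x \<in> X; y \<in> X;
      \<And>h. \<exists>v. snd v < h \<and> (\<forall>m. 0 \<le> snd m \<and> snd m < r \<longrightarrow> x (v + m) = y m)\<rbrakk> \<Longrightarrow>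
      subpattern_le x y \<or> (\<exists>c h. snd c \<noteq> 0 \<and> (\<forall>m. snd m \<le> h \<longrightarrow> x (c + m) = x m))"
begin

text \<open>The rank that decreases along chains. The maximum over all translates makes it
  independent of position, and the uniform bound on defects makes it well defined.\<close>

definition max_defects :: "(int \<times> int \<Rightarrow> 'a) \<Rightarrow> nat" where
  "max_defects x = Max (range (\<lambda>v. card (defects r p (shift v x))))"

lemma finite_range_card_defects:
  assumes "x \<in> X" shows "finite (range (\<lambda>v. card (defects r p (shift v x))))"
proof (rule finite_subset)
  show "range (\<lambda>v. card (defects r p (shift v x))) \<subseteq> {..K}"
    using defects[OF shift_closed[OF assms]] by auto
qed simp

lemma card_defects_le_max: "x \<in> X \<Longrightarrow> card (defects r p (shift v x)) \<le> max_defects x"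
  unfolding max_defects_def by (intro Max_ge finite_range_card_defects rangeI)

lemma max_defects_attained:
  assumes "x \<in> X" obtains v where "card (defects r p (shift v x)) = max_defects x"
proof -
  have "max_defects x \<in> range (\<lambda>v. card (defects r p (shift v x)))"
    unfolding max_defects_def using finite_range_card_defects[OF assms] by (intro Max_in) auto
  then obtain v where "max_defects x = card (defects r p (shift v x))" by auto
  then show thesis by (intro that) simp
qed

lemma max_defects_le:
  assumes "x \<in> X" shows "max_defects x \<le> K"
proof -
  obtain v where v: "card (defects r p (shift v x)) = max_defects x"
    using max_defects_attained[OF assms] .
  then show ?thesis using defects[OF shift_closed[OF assms], of v] by simp
qed

text \<open>Each defect is witnessed by two cells, so a finite pattern around a maximal defect set
  of \<open>y\<close> carries all its defects into \<open>x\<close>.\<close>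

lemma max_defects_mono:
  assumes x: "x \<in> X" and y: "y \<in> X" and le: "subpattern_le y x"
  shows "max_defects y \<le> max_defects x"
proof -
  obtain v where v: "card (defects r p (shift v y)) = max_defects y"
    using max_defects_attained[OF y] .
  define D where "D = defects r p (shift v y)"
  have "finite (D \<union> (\<lambda>m. m + (p, 0)) ` D)"
    using defects shift_closed[OF y] by (simp add: D_def)
  moreover have "subpattern_le (shift v y) x"
    using subpattern_le_shift_self le by (rule subpattern_le_trans)
  ultimately obtain u where u: "\<forall>m\<in>D \<union> (\<lambda>m. m + (p, 0)) ` D. x (u + m) = shift v y m"
    unfolding subpattern_le_iff by blast
  have "D \<subseteq> defects r p (shift u x)"
  proof
    fix m assume m: "m \<in> D"
    have "x (u + m) = shift v y m" "x (u + (m + (p, 0))) = shift v y (m + (p, 0))"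
      using u m by blast+
    then show "m \<in> defects r p (shift u x)"
      using m by (auto simp: D_def defects_def shift_def)
  qed
  then have "card D \<le> card (defects r p (shift u x))"
    using defects shift_closed[OF x] by (intro card_mono) auto
  then show ?thesis using card_defects_le_max[OF x, of u] v by (simp add: D_def)
qed

text \<open>A copy of the maximal defect set of \<open>y\<close> leaves no room for further defects of \<open>x\<close>, so
  periodicity away from the defects determines whole rows.\<close>

lemma block_determined:
  assumes x: "x \<in> X" and y: "y \<in> X" and max: "max_defects x \<le> card (defects r p y)"
  obtains A where "finite A"
    "\<And>v m. (\<And>m. m \<in> A \<Longrightarrow> x (v + m) = y m) \<Longrightarrow> 0 \<le> snd m \<Longrightarrow> snd m < r \<Longrightarrow> x (v + m) = y m"
proof -
  obtain N where N: "0 \<le> N" "\<And>m. m \<in> defects r p y \<Longrightarrow> \<bar>fst m\<bar> \<le> N"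
    using finite_int_bound[of "defects r p y" fst] defects[OF y] by blast
  \<comment> \<open>The window exceeds the defects by one period on either side, so that known
    values reach far enough to be continued periodically.\<close>
  define A where "A = {- N - p..N + p} \<times> {0..<r}"
  have "x (v + m) = y m"
    if A: "\<And>m. m \<in> A \<Longrightarrow> x (v + m) = y m" and m: "0 \<le> snd m" "snd m < r" for v m
  proof -
    have sub: "defects r p y \<subseteq> defects r p (shift v x)"
    proof
      fix m assume m: "m \<in> defects r p y"
      then have "m \<in> A" "m + (p, 0) \<in> A"
        using N(2)[OF m] m p by (auto simp: A_def defects_def mem_Times_iff)
      from A[OF this(1)] A[OF this(2)] show "m \<in> defects r p (shift v x)"
        using m by (auto simp: defects_def shift_def)
    qed
    \<comment> \<open>The larger set is finite and has at most \<open>max_defects x\<close>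
      elements, which the smaller one already has.\<close>
    have eq: "defects r p y = defects r p (shift v x)"
      using sub defects[OF shift_closed[OF x, of v]] card_defects_le_max[OF x, of v] max
      by (intro card_subset_eq) (auto intro: antisym card_mono)
    have per: "x (v + (m + (p, 0))) = x (v + m)" "y (m + (p, 0)) = y m"
      if "N < \<bar>fst m\<bar>" "0 \<le> snd m" "snd m < r" for m
    proof -
      have "m \<notin> defects r p y" using N(2)[of m] that(1) by auto
      moreover from this have "m \<notin> defects r p (shift v x)" unfolding eq .
      ultimately show "x (v + (m + (p, 0))) = x (v + m)" "y (m + (p, 0)) = y m"
        using that(2,3) by (simp_all add: defects_def shift_def)
    qed
    \<comment> \<open>Outside the window a step of length \<open>p\<close> towards the centre
      crosses no defect of either configuration.\<close>
    have "\<forall>m. \<bar>fst m\<bar> \<le> int n \<longrightarrow> 0 \<le> snd m \<longrightarrow> snd m < r \<longrightarrow> x (v + m) = y m" for n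
    proof (induction n)
      case 0
      then show ?case using N(1) p by (auto intro!: A simp: A_def)
    next
      case (Suc n)
      show ?case
      proof (intro allI impI)
        fix m :: "int \<times> int"
        assume m: "\<bar>fst m\<bar> \<le> int (Suc n)" "0 \<le> snd m" "snd m < r"
        consider "\<bar>fst m\<bar> \<le> N + p" | "N + p < fst m" | "fst m < - N - p" by linarith
        then show "x (v + m) = y m"
        proof cases
          case 1
          then show ?thesis using m by (intro A) (auto simp: A_def mem_Times_iff)
        next
          case 2
          let ?m = "m - (p, 0)"
          have "x (v + ?m) = y ?m"
            using m 2 p N(1) by (intro Suc[rule_format]) auto
          moreover have "x (v + (?m + (p, 0))) = x (v + ?m)" "y (?m + (p, 0)) = y ?m"
            using 2 m by (intro per; simp)+
          ultimately show ?thesis by simp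
        next
          case 3
          have "x (v + (m + (p, 0))) = y (m + (p, 0))"
            using m 3 p N(1) by (intro Suc[rule_format]) auto
          moreover have "x (v + (m + (p, 0))) = x (v + m)" "y (m + (p, 0)) = y m"
            using 3 m p by (intro per; simp)+
          ultimately show ?thesis by simp
        qed
      qed
    qed
    from this[of "nat \<bar>fst m\<bar>", rule_format, of m] m show ?thesis by simp
  qed
  then show thesis by (intro that[of A]) (auto simp: A_def)
qed

text \<open>At a fixed height, \<open>x\<close> contains the maximal block of \<open>y\<close> at most once if that block has
  defects, and otherwise its horizontal position matters only modulo \<open>p\<close>.\<close>

lemma le_of_bounded_heights:
  assumes x: "x \<in> X" and y: "y \<in> X" and max: "max_defects x \<le> card (defects r p y)"
    and "finite C"
    and occ: "\<And>A. finite A \<Longrightarrow> \<exists>v. snd v \<in> C \<and> (\<forall>m\<in>A. x (v + m) = y m)"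
  shows "subpattern_le x y"
proof -
  obtain A0 where A0: "finite A0" "\<And>v m. (\<And>m. m \<in> A0 \<Longrightarrow> x (v + m) = y m) \<Longrightarrow>
      0 \<le> snd m \<Longrightarrow> snd m < r \<Longrightarrow> x (v + m) = y m"
    using block_determined[OF x y max] by metis
  have "\<exists>V. finite V \<and> (\<forall>A. finite A \<longrightarrow> (\<exists>v\<in>V. \<forall>m\<in>A. x (v + m) = y m))"
  proof (cases "defects r p y = {}")
    case True
    \<comment> \<open>With no defects in the block of \<open>y\<close>, the maximum for
      \<open>x\<close> is 0, so all of \<open>x\<close> has the horizontal period
      \<open>p\<close>.\<close>
    have "x (v + (p, 0)) = x v" for v
    proof -
      have "card (defects r p (shift v x)) = 0"
        using card_defects_le_max[OF x, of v] max True by simp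
      then have "0 \<notin> defects r p (shift v x)"
        using defects[OF shift_closed[OF x, of v]] by auto
      then show ?thesis using r by (simp add: defects_def shift_def)
    qed
    then have per: "x ((p, 0) + v) = x v" for v by (simp add: add.commute)
    have "\<exists>v\<in>{0..<p} \<times> C. \<forall>m\<in>A. x (v + m) = y m" if fin: "finite A" for A
    proof -
      obtain v where v: "snd v \<in> C" "\<forall>m\<in>A. x (v + m) = y m" using occ[OF fin] by blast
      have "x ((fst v mod p, snd v) + m) = x (v + m)" for m
      proof -
        have "(fst v div p * fst (p, 0), fst v div p * snd (p, 0)) + ((fst v mod p, snd v) + m) = v + m"
          by (simp add: prod_eq_iff)
        then show ?thesis
          using period_multiple[of x "(p, 0)", OF per, of "fst v div p" "(fst v mod p, snd v) + m"] by metis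
      qed
      moreover have "(fst v mod p, snd v) \<in> {0..<p} \<times> C" using v(1) p by simp
      ultimately show ?thesis using v(2) by metis
    qed
    then show ?thesis using \<open>finite C\<close> by (intro exI[of _ "{0..<p} \<times> C"]) auto
  next
    case False
    define V where "V = {v. snd v \<in> C \<and> (\<forall>m\<in>A0. x (v + m) = y m)}"
    have block: "x (v + m) = y m" if "v \<in> V" "0 \<le> snd m" "snd m < r" for v m
    proof (rule A0(2)[OF _ that(2,3)])
      show "x (v + n) = y n" if "n \<in> A0" for n
        using \<open>v \<in> V\<close> that by (simp add: V_def)
    qed
    \<comment> \<open>Two occurrences at the same height would give the block of \<open>y\<close> a
      horizontal period, which would move its rightmost defect further right.\<close>
    have not_less: "\<not> fst v < fst v'" if v: "v \<in> V" "v' \<in> V" "snd v = snd v'" for v v'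
    proof
      assume less: "fst v < fst v'"
      define t where "t = fst v' - fst v"
      have t: "v' = v + (t, 0)" using v(3) by (simp add: t_def prod_eq_iff)
      have "fst ` defects r p y \<noteq> {}" "finite (fst ` defects r p y)"
        using False defects[OF y] by auto
      then obtain m where m: "m \<in> defects r p y" "fst m = Max (fst ` defects r p y)"
        by (metis (no_types, lifting) Max_in imageE)
      have y_per: "y (u + (t, 0)) = y u" if "0 \<le> snd u" "snd u < r" for u
        using block[OF v(1), of "u + (t, 0)"] block[OF v(2), of u] that by (simp add: t add_ac)
      have "m + (t, 0) \<in> defects r p y"
        using m(1) y_per[of m] y_per[of "m + (p, 0)"] by (auto simp: defects_def add_ac)
      then have "fst (m + (t, 0)) \<le> Max (fst ` defects r p y)"
        using defects[OF y] by (intro Max_ge imageI) auto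
      then show False using m(2) less by (simp add: t_def)
    qed
    have "inj_on snd V"
      using not_less by (intro inj_onI) (metis linorder_cases prod_eq_iff)
    moreover have "snd ` V \<subseteq> C" by (auto simp: V_def)
    ultimately have "finite V" using \<open>finite C\<close> by (meson inj_on_finite)
    moreover have "\<exists>v\<in>V. \<forall>m\<in>A. x (v + m) = y m" if "finite A" for A
    proof -
      have "finite (A \<union> A0)" using that A0(1) by simp
      then obtain v where "snd v \<in> C" "\<forall>m\<in>A \<union> A0. x (v + m) = y m" using occ by blast
      then show ?thesis by (intro bexI[of _ v]) (simp_all add: V_def)
    qed
    ultimately show ?thesis by blast
  qed
  then obtain V where "finite V" "\<And>A. finite A \<Longrightarrow> \<exists>v\<in>V. \<forall>m\<in>A. x (v + m) = y m" by blast
  \<comment> \<open>Since \<open>V\<close> is finite, a single translation matches all windows, so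
    \<open>y\<close> is a translate of \<open>x\<close>.\<close>
  from finite_directed_choice[OF this] obtain v where "\<forall>m. x (v + m) = y m" by blast
  then have "y = shift v x" by (auto simp: shift_def)
  then show ?thesis by (simp add: subpattern_le_self_shift)
qed

text \<open>Adding a multiple of \<open>c\<close> to an occurrence reduces its height modulo
  \<open>snd c\<close>, so heights from a finite range suffice. The range is symmetric because
  \<open>snd c\<close> may be negative.\<close>

lemma le_of_vertical_period:
  assumes x: "x \<in> X" and y: "y \<in> X" and max: "max_defects x \<le> card (defects r p y)"
    and le: "subpattern_le y x" and c: "snd c \<noteq> 0" and per: "\<And>m. x (c + m) = x m"
  shows "subpattern_le x y"
proof (rule le_of_bounded_heights[OF x y max])
  show "finite {- \<bar>snd c\<bar>..\<bar>snd c\<bar>}" by simp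
  fix A :: "(int \<times> int) set" assume "finite A"
  then obtain v where v: "\<forall>m\<in>A. x (v + m) = y m" using le unfolding subpattern_le_iff by blast
  define k where "k = - (snd v div snd c)"
  define u where "u = (k * fst c, k * snd c) + v"
  have "snd u = snd v mod snd c"
    by (simp add: u_def k_def minus_div_mult_eq_mod[symmetric])
  then have "snd u \<in> {- \<bar>snd c\<bar>..\<bar>snd c\<bar>}"
    using abs_mod_less[OF c, of "snd v"] by auto
  moreover have "x (u + m) = x (v + m)" for m
    using period_multiple[of x c, OF per, of k "v + m"] by (simp add: u_def add.assoc)
  ultimately show "\<exists>v. snd v \<in> {- \<bar>snd c\<bar>..\<bar>snd c\<bar>} \<and> (\<forall>m\<in>A. x (v + m) = y m)"
    using v by metis
qed

text \<open>If all windows of \<open>y\<close> recur arbitrarily high or arbitrarily low in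
  \<open>x\<close>, a half-plane period of \<open>x\<close> is inherited by all of \<open>y\<close>.
  Otherwise one window bounds the heights from above, another from below, and the case of bounded
  heights applies.\<close>

lemma le_or_vertical_period:
  assumes x: "x \<in> X" and y: "y \<in> X" and max: "max_defects x \<le> card (defects r p y)"
    and le: "subpattern_le y x"
  shows "subpattern_le x y \<or> (\<exists>c. snd c \<noteq> 0 \<and> (\<forall>m. y (c + m) = y m))"
proof (rule ccontr)
  assume contra: "\<not> ?thesis"
  obtain A0 where A0: "finite A0" "\<And>v m. (\<And>m. m \<in> A0 \<Longrightarrow> x (v + m) = y m) \<Longrightarrow>
      0 \<le> snd m \<Longrightarrow> snd m < r \<Longrightarrow> x (v + m) = y m"
    using block_determined[OF x y max] by metis
  define R where "R A v \<longleftrightarrow> (\<forall>m\<in>A. x (v + m) = y m)" for A v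
  have R_mono: "R A v" if "R B v" "A \<subseteq> B" for A B v
    using that by (auto simp: R_def)
  have block: "\<forall>m. 0 \<le> snd m \<and> snd m < r \<longrightarrow> x (v + m) = y m" if "R A0 v" for v
    using A0(2) that by (auto simp: R_def)
  have above: "\<exists>A h. finite A \<and> (\<forall>v. R A v \<longrightarrow> snd v \<le> h)"
  proof (rule ccontr)
    assume "\<not> ?thesis"
    then have ex: "\<exists>v. h < snd v \<and> R A v" if "finite A" for A h
      using that by (meson not_le)
    have "\<exists>v. h < snd v \<and> (\<forall>m. 0 \<le> snd m \<and> snd m < r \<longrightarrow> x (v + m) = y m)" for h
      using ex[OF A0(1), of h] block by blast
    then obtain c h where c: "snd c \<noteq> 0" "\<And>m. h \<le> snd m \<Longrightarrow> x (c + m) = x m"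
      using returns_above[OF x y] contra by blast
    have "y (c + m) = y m" for m
    proof -
      \<comment> \<open>An occurrence showing both \<open>m\<close> and \<open>c + m\<close> is
        placed so high that \<open>v + m\<close> lies where \<open>x\<close> is periodic.\<close>
      obtain v where v: "h - snd m < snd v" "R {m, c + m} v" using ex[of "{m, c + m}" "h - snd m"] by blast
      then have "y (c + m) = x (c + (v + m))" "y m = x (v + m)" by (auto simp: R_def add_ac)
      then show ?thesis using c(2)[of "v + m"] v(1) by simp
    qed
    then show False using contra c(1) by blast
  qed
  have below: "\<exists>A h. finite A \<and> (\<forall>v. R A v \<longrightarrow> h \<le> snd v)"
  proof (rule ccontr)
    assume "\<not> ?thesis"
    then have ex: "\<exists>v. snd v < h \<and> R A v" if "finite A" for A h
      using that by (meson not_le)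
    have "\<exists>v. snd v < h \<and> (\<forall>m. 0 \<le> snd m \<and> snd m < r \<longrightarrow> x (v + m) = y m)" for h
      using ex[OF A0(1), of h] block by blast
    then obtain c h where c: "snd c \<noteq> 0" "\<And>m. snd m \<le> h \<Longrightarrow> x (c + m) = x m"
      using returns_below[OF x y] contra by blast
    have "y (c + m) = y m" for m
    proof -
      obtain v where v: "snd v < h - snd m" "R {m, c + m} v" using ex[of "{m, c + m}" "h - snd m"] by blast
      then have "y (c + m) = x (c + (v + m))" "y m = x (v + m)" by (auto simp: R_def add_ac)
      then show ?thesis using c(2)[of "v + m"] v(1) by simp
    qed
    then show False using contra c(1) by blast
  qed
  obtain A1 h1 where A1: "finite A1" "\<And>v. R A1 v \<Longrightarrow> snd v \<le> h1" using above by blast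
  obtain A2 h2 where A2: "finite A2" "\<And>v. R A2 v \<Longrightarrow> h2 \<le> snd v" using below by blast
  have "subpattern_le x y"
  proof (rule le_of_bounded_heights[OF x y max])
    show "finite {h2..h1}" by (rule finite_atLeastAtMost_int)
    fix A :: "(int \<times> int) set" assume "finite A"
    \<comment> \<open>Enlarging the window by \<open>A1\<close> and \<open>A2\<close> forces its
      occurrence into the bounded range of heights.\<close>
    then have "finite (A \<union> A1 \<union> A2)" using A1(1) A2(1) by simp
    then obtain v where "R (A \<union> A1 \<union> A2) v"
      using le unfolding subpattern_le_iff R_def by meson
    then have "R A v" "R A1 v" "R A2 v" by (auto intro: R_mono)
    then show "\<exists>v. snd v \<in> {h2..h1} \<and> (\<forall>m\<in>A. x (v + m) = y m)"
      using A1(2)[of v] A2(2)[of v] unfolding R_def by (intro exI[of _ v]) simp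
  qed
  then show False using contra by blast
qed

text \<open>If the rank were constant, the step from \<open>x\<close> to \<open>y\<close> would give
  \<open>y\<close> a period with nonzero height, and this would force \<open>y\<close> below
  \<open>z\<close>.\<close>

lemma max_defects_drop:
  assumes x: "x \<in> X" and y: "y \<in> X" and z: "z \<in> X"
    and xy: "subpattern_less y x" and yz: "subpattern_less z y"
  shows "max_defects z < max_defects x"
proof (rule ccontr)
  assume "\<not> ?thesis"
  moreover have "max_defects z \<le> max_defects y" "max_defects y \<le> max_defects x"
    using xy yz by (auto simp: subpattern_less_def intro: max_defects_mono x y z)
  ultimately have eq: "max_defects z = max_defects y" "max_defects y = max_defects x" by auto
  have le: "subpattern_le y x" "subpattern_le z y" and nle: "\<not> subpattern_le x y" "\<not> subpattern_le y z"
    using xy yz by (auto simp: subpattern_less_def)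
  \<comment> \<open>Translating \<open>y\<close> and \<open>z\<close> puts a block with the maximal
    number of defects at height 0.\<close>
  obtain u where u: "card (defects r p (shift u y)) = max_defects y" using max_defects_attained[OF y] .
  obtain v where v: "card (defects r p (shift v z)) = max_defects z" using max_defects_attained[OF z] .
  have "subpattern_le (shift u y) x" "\<not> subpattern_le x (shift u y)"
    using le(1) nle(1) subpattern_le_trans subpattern_le_shift_self by blast+
  then obtain c where c: "snd c \<noteq> 0" "\<forall>m. shift u y (c + m) = shift u y m"
    using le_or_vertical_period[OF x shift_closed[OF y, of u]] u eq by auto
  have "y (c + m) = y m" for m
    using c(2)[rule_format, of "m - u"] by (simp add: shift_def algebra_simps)
  moreover have "subpattern_le (shift v z) y"
    using le(2) subpattern_le_trans subpattern_le_shift_self by blast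
  ultimately have "subpattern_le y (shift v z)"
    using v eq by (intro le_of_vertical_period[OF y shift_closed[OF z] _ _ c(1)]) auto
  then show False using nle(2) subpattern_le_trans subpattern_le_shift_self by blast
qed

text \<open>The \<open>K + 2\<close> odd indices up to \<open>2 * K + 3\<close> would give
  \<open>K + 1\<close> strict decreases of a natural number that starts at most at
  \<open>K\<close>.\<close>

lemma no_long_chain:
  assumes X: "\<And>i. i \<in> {1..2 * K + 3} \<Longrightarrow> x i \<in> X"
    and less: "\<And>i. i \<in> {1..<2 * K + 3} \<Longrightarrow> subpattern_less (x (i + 1)) (x i)"
  shows False
proof -
  have "max_defects (x (2 * i + 1)) + i \<le> K" if "i \<le> K + 1" for i
    using that
  proof (induction i)
    case 0
    then show ?case using max_defects_le X by simp
  next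
    case (Suc i)
    have "max_defects (x (2 * i + 1 + 1 + 1)) < max_defects (x (2 * i + 1))"
      using Suc.prems by (intro max_defects_drop[of _ "x (2 * i + 1 + 1)"] X less) auto
    then show ?case using Suc by simp
  qed
  from this[of "K + 1"] show False by simp
qed

end

section \<open>Transport along the conjugacy\<close>

text \<open>Only the vertical extent of the window is kept, since gluing and determinism concern
  whole rows.\<close>

lemma local_on_rows:
  fixes X :: "(int \<times> int \<Rightarrow> 'a) set"
  assumes "finite A" "local_on A X f"
  shows "\<exists>R\<ge>0. \<forall>x\<in>X. \<forall>y\<in>X. \<forall>v. (\<forall>m. \<bar>snd m - snd v\<bar> \<le> R \<longrightarrow> x m = y m) \<longrightarrow> f x v = f y v"
proof -
  obtain R where R: "0 \<le> R" "\<And>m. m \<in> A \<Longrightarrow> \<bar>snd m\<bar> \<le> R"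
    using finite_int_bound[OF assms(1), of snd] by blast
  have "f x v = f y v"
    if "x \<in> X" "y \<in> X" "\<forall>m. \<bar>snd m - snd v\<bar> \<le> R \<longrightarrow> x m = y m" for x y v
    by (rule local_onD[OF assms(2) that(1,2)]) (use R(2) that(3)[rule_format] in simp)
  then show ?thesis using R(1) by blast
qed

text \<open>Two configurations are pulled back to \<open>X\<close> by \<open>g\<close>, glued there,
  and mapped forward by \<open>f\<close>.\<close>

lemma conjugate_glueable:
  fixes X :: "(int \<times> int \<Rightarrow> 'a) set" and Y :: "(int \<times> int \<Rightarrow> 'b) set"
  assumes "glueable snd r X" "0 < r" "finite A" "local_on A X f" "local_on A Y g"
    and fg: "\<And>y. y \<in> Y \<Longrightarrow> f (g y) = y" and fY: "\<And>x. x \<in> X \<Longrightarrow> f x \<in> Y"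
    and gX: "\<And>y. y \<in> Y \<Longrightarrow> g y \<in> X" and Xs: "\<forall>x\<in>X. \<forall>v. shift v x \<in> X"
  shows "\<exists>s>0. glueable snd s Y"
proof -
  obtain R where R: "0 \<le> R" and f: "\<forall>x\<in>X. \<forall>y\<in>X. \<forall>v.
      (\<forall>m. \<bar>snd m - snd v\<bar> \<le> R \<longrightarrow> x m = y m) \<longrightarrow> f x v = f y v"
    using local_on_rows[OF assms(3,4)] by blast
  obtain Q where Q: "0 \<le> Q" and g: "\<forall>x\<in>Y. \<forall>y\<in>Y. \<forall>v.
      (\<forall>m. \<bar>snd m - snd v\<bar> \<le> Q \<longrightarrow> x m = y m) \<longrightarrow> g x v = g y v"
    using local_on_rows[OF assms(3,5)] by blast
  define h where "h = Q + R"
  \<comment> \<open>Pulling back costs \<open>Q\<close> rows at each end of the overlap and mapping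
    forward costs \<open>R\<close> more; \<open>r\<close> common rows remain for the gluing at
    height \<open>h\<close>.\<close>
  define s where "s = 2 * h + r"
  have "glue snd y z \<in> Y"
    if yz: "y \<in> Y" "z \<in> Y" and eq: "\<forall>m. 0 \<le> snd m \<and> snd m < s \<longrightarrow> y m = z m" for y z
  proof -
    have agree: "g y v = g z v" if "Q \<le> snd v" "snd v < s - Q" for v
    proof -
      have "\<forall>m. \<bar>snd m - snd v\<bar> \<le> Q \<longrightarrow> y m = z m"
        using that by (intro allI impI eq[rule_format]) linarith
      then show ?thesis using g yz by blast
    qed
    define w where "w m = (if h \<le> snd m then g y m else g z m)" for m
    have "w \<in> X"
      unfolding w_def
    proof (rule glueable_at[OF assms(1) Xs gX[OF yz(1)] gX[OF yz(2)]])
      show "g y m = g z m" if "h \<le> snd m" "snd m < h + r" for m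
        using that R Q by (intro agree) (simp_all add: h_def s_def)
    qed
    have wy: "w m = g y m" if "Q \<le> snd m" for m
      using agree[of m] that R Q assms(2) by (simp add: w_def h_def s_def)
    have wz: "w m = g z m" if "snd m < s - Q" for m
      using agree[of m] that R Q by (simp add: w_def h_def)
    have fy: "f w v = y v" if "h \<le> snd v" for v
    proof -
      have "\<forall>m. \<bar>snd m - snd v\<bar> \<le> R \<longrightarrow> w m = g y m"
        using that by (auto intro!: wy simp: h_def)
      then have "f w v = f (g y) v" using f \<open>w \<in> X\<close> gX[OF yz(1)] by blast
      then show ?thesis by (simp add: fg yz)
    qed
    have fz: "f w v = z v" if "snd v < s - h" for v
    proof -
      have "\<forall>m. \<bar>snd m - snd v\<bar> \<le> R \<longrightarrow> w m = g z m"
        using that by (auto intro!: wz simp: h_def)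
      then have "f w v = f (g z) v" using f \<open>w \<in> X\<close> gX[OF yz(2)] by blast
      then show ?thesis by (simp add: fg yz)
    qed
    have "f w = glue snd y z"
    proof
      fix v
      show "f w v = glue snd y z v"
      proof (cases "h \<le> snd v")
        case True
        then show ?thesis using fy[OF True] R Q by (simp add: glue_def h_def)
      next
        case False
        then have "snd v < s - h" using assms(2) by (simp add: s_def)
        then show ?thesis using fz[of v] eq[rule_format, of v] False assms(2) R Q by (simp add: glue_def s_def h_def)
      qed
    qed
    then show ?thesis using fY[OF \<open>w \<in> X\<close>] by simp
  qed
  then have "glueable snd s Y" by (simp add: glueable_def)
  then show ?thesis using R Q assms(2) by (intro exI[of _ s]) (simp add: s_def h_def)
qed

text \<open>Determinism passes to \<open>Y\<close> through \<open>g\<close>, whose window costs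
  \<open>Q\<close> rows, recovered by a vertical shift. Compactness then bounds how many rows above
  a cell determine it, and induction proceeds downwards row by row.\<close>

lemma conjugate_deterministic:
  fixes X :: "(int \<times> int \<Rightarrow> 'a) set" and Y :: "(int \<times> int \<Rightarrow> 'b) set"
  assumes det: "downward_deterministic X" and Y: "subshift T Y"
    and A: "finite A" "local_on A Y g"
    and fg: "\<And>y. y \<in> Y \<Longrightarrow> f (g y) = y" 
    and gX: "\<And>y. y \<in> Y \<Longrightarrow> g y \<in> X" and Xs: "\<And>x v. x \<in> X \<Longrightarrow> shift v x \<in> X"
  shows "\<exists>s>0. \<forall>y\<in>Y. \<forall>z\<in>Y. (\<forall>m. 0 \<le> snd m \<and> snd m < s \<longrightarrow> y m = z m) \<longrightarrow>
    (\<forall>m. snd m < s \<longrightarrow> y m = z m)"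
proof -
  obtain Q where Q: "0 \<le> Q" and g: "\<forall>x\<in>Y. \<forall>y\<in>Y. \<forall>v.
      (\<forall>m. \<bar>snd m - snd v\<bar> \<le> Q \<longrightarrow> x m = y m) \<longrightarrow> g x v = g y v"
    using local_on_rows[OF A] by blast
  have detY: "y = z" if yz: "y \<in> Y" "z \<in> Y" and eq: "\<And>m. m \<in> upper_half_plane \<Longrightarrow> y m = z m" for y z
  proof -
    have "shift (0, Q) (g y) v = shift (0, Q) (g z) v" if "v \<in> upper_half_plane" for v
    proof -
      have "\<forall>m. \<bar>snd m - snd ((0, Q) + v)\<bar> \<le> Q \<longrightarrow> y m = z m"
        using that by (auto intro!: eq simp: upper_half_plane_def)
      then show ?thesis using g yz unfolding shift_def by blast
    qed
    then have "shift (0, Q) (g y) = shift (0, Q) (g z)"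
      using det Xs[OF gX[OF yz(1)]] Xs[OF gX[OF yz(2)]] unfolding downward_deterministic_def by blast
    then have "shift (0, - Q) (shift (0, Q) (g y)) = shift (0, - Q) (shift (0, Q) (g z))" by simp
    then have "g y = g z" by (simp add: shift_shift flip: zero_prod_def)
    then show ?thesis using fg[OF yz(1)] fg[OF yz(2)] by metis
  qed
  have cl: "finite T" "closedin (full_shift T) Y" using Y by (auto simp: subshift_def)
  have "\<exists>B. finite B \<and> B \<subseteq> upper_half_plane \<and>
      (\<forall>y\<in>Y. \<forall>z\<in>Y. (\<forall>m\<in>B. y m = z m) \<longrightarrow> y 0 = z 0)"
  proof (rule compact_finite_determination[OF cl])
    show "y 0 = z 0" if "y \<in> Y" "z \<in> Y" "\<And>m. m \<in> upper_half_plane \<Longrightarrow> y m = z m" for y z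
      by (rule fun_cong[OF detY[OF that]])
  qed (rule continuous_map_from_subtopology[OF continuous_map_full_shift_component])+
  then obtain B where B: "finite B" "B \<subseteq> upper_half_plane"
    "\<forall>y\<in>Y. \<forall>z\<in>Y. (\<forall>m\<in>B. y m = z m) \<longrightarrow> y 0 = z 0" by blast
  obtain N where N: "0 \<le> N" "\<And>m. m \<in> B \<Longrightarrow> \<bar>snd m\<bar> \<le> N"
    using finite_int_bound[OF B(1), of snd] by blast
  \<comment> \<open>The rows at distances 1 to \<open>N\<close> above a cell determine it; the extra
    row keeps \<open>s\<close> positive when \<open>N\<close> is 0.\<close>
  define s where "s = N + 1"
  have "y m = z m" if yz: "y \<in> Y" "z \<in> Y" and eq: "\<forall>m. 0 \<le> snd m \<and> snd m < s \<longrightarrow> y m = z m"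
    and m: "snd m < s" for y z m
  proof -
    have "\<forall>m. - int n \<le> snd m \<longrightarrow> snd m < s \<longrightarrow> y m = z m" for n
    proof (induction n)
      case 0
      then show ?case using eq by simp
    next
      case (Suc n)
      show ?case
      proof (intro allI impI)
        fix m :: "int \<times> int" assume m: "- int (Suc n) \<le> snd m" "snd m < s"
        show "y m = z m"
        proof (cases "- int n \<le> snd m")
          case True
          then show ?thesis using Suc m(2) by blast
        next
          case False
          have "shift m y k = shift m z k" if "k \<in> B" for k
          proof -
            have "1 \<le> snd k" using that B(2) by (auto simp: upper_half_plane_def)
            then show ?thesis
              using Suc[rule_format, of "m + k"] m False N(2)[OF that] by (simp add: shift_def s_def)
          qed
          then have "shift m y 0 = shift m z 0"
            using B(3) subshift_shift[OF Y yz(1)] subshift_shift[OF Y yz(2)] by blast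
          then show ?thesis by (simp add: shift_def)
        qed
      qed
    qed
    from this[of "nat \<bar>snd m\<bar>", rule_format, of m] m show ?thesis by simp
  qed
  then show ?thesis using N(1) by (intro exI[of _ s]) (simp add: s_def)
qed

section \<open>Returns of a block of rows\<close>

context countable_glueable
begin

text \<open>From the return \<open>v\<close>, both \<open>u - v\<close> and \<open>t - v\<close> are
  loops at the same block. They commute, so \<open>u - v\<close> is a period of \<open>x\<close>
  between \<open>v\<close> and \<open>t\<close>, and \<open>t\<close> may be arbitrarily
  high.\<close>

lemma returns_above_period:
  assumes r: "0 < r" and x: "x \<in> X"
    and ret: "\<And>h. \<exists>v. h < snd v \<and> (\<forall>m. 0 \<le> snd m \<and> snd m < r \<longrightarrow> x (v + m) = y m)"
  shows "\<exists>c h. snd c \<noteq> 0 \<and> (\<forall>m. h \<le> snd m \<longrightarrow> x (c + m) = x m)"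
proof -
  obtain v where v: "\<forall>m. 0 \<le> snd m \<and> snd m < r \<longrightarrow> x (v + m) = y m"
    using ret by blast
  obtain u where u: "snd v < snd u" "\<forall>m. 0 \<le> snd m \<and> snd m < r \<longrightarrow> x (u + m) = y m"
    using ret by blast
  have "x (u - v + m) = x m" if m: "snd v \<le> snd m" for m
  proof -
    obtain t where t: "max (snd v) (snd (u - v + m)) < snd t"
      "\<forall>m. 0 \<le> snd m \<and> snd m < r \<longrightarrow> x (t + m) = y m"
      using ret by blast
    have "shift v x (u - v + (m - v)) = shift v x (m - v)"
    proof (rule loops_commute[OF shift_closed[OF x] shift_closed[OF x] refl])
      show "shift v x (u - v + m) = shift v x m" if "0 \<le> snd m" "snd m < r" for m
        using u(2)[rule_format, of m] v[rule_format, of m] that by (simp add: shift_def algebra_simps)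
      show "shift v x (t - v + m) = shift v x m" if "0 \<le> snd m" "snd m < r" for m
        using t(2)[rule_format, of m] v[rule_format, of m] that by (simp add: shift_def algebra_simps)
    qed (use r m u(1) t(1) in simp_all)
    then show ?thesis by (simp add: shift_def algebra_simps)
  qed
  then show ?thesis using u(1) by (intro exI[of _ "u - v"] exI[of _ "snd v"]) simp
qed

text \<open>The long loop now starts at an arbitrarily low return \<open>t\<close> and ends at
  \<open>v\<close>; the loop from \<open>u\<close> to \<open>v\<close> supplies the period.\<close>

lemma returns_below_period:
  assumes r: "0 < r" and x: "x \<in> X"
    and ret: "\<And>h. \<exists>v. snd v < h \<and> (\<forall>m. 0 \<le> snd m \<and> snd m < r \<longrightarrow> x (v + m) = y m)"
  shows "\<exists>c h. snd c \<noteq> 0 \<and> (\<forall>m. snd m \<le> h \<longrightarrow> x (c + m) = x m)"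
proof -
  obtain v where v: "\<forall>m. 0 \<le> snd m \<and> snd m < r \<longrightarrow> x (v + m) = y m"
    using ret by blast
  obtain u where u: "snd u < snd v" "\<forall>m. 0 \<le> snd m \<and> snd m < r \<longrightarrow> x (u + m) = y m"
    using ret by blast
  have "x (v - u + m) = x m" if m: "snd m \<le> snd u" for m
  proof -
    obtain t where t: "snd t < min (snd v) (snd m)"
      "\<forall>m. 0 \<le> snd m \<and> snd m < r \<longrightarrow> x (t + m) = y m"
      using ret by blast
    have "shift t x (v - u + (m - t)) = shift t x (m - t)"
    proof (rule loops_commute[OF shift_closed[OF x] shift_closed[OF x]])
      show "shift u x m = shift t x m" if "0 \<le> snd m" "snd m < r" for m
        using u(2)[rule_format, of m] t(2)[rule_format, of m] that by (simp add: shift_def)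
      show "shift u x (v - u + m) = shift u x m" if "0 \<le> snd m" "snd m < r" for m
        using u(2)[rule_format, of m] v[rule_format, of m] that by (simp add: shift_def algebra_simps)
      show "shift t x (v - t + m) = shift t x m" if "0 \<le> snd m" "snd m < r" for m
        using t(2)[rule_format, of m] v[rule_format, of m] that by (simp add: shift_def algebra_simps)
    qed (use r m u(1) t(1) in simp_all)
    then show ?thesis by (simp add: shift_def algebra_simps)
  qed
  then show ?thesis using u(1) by (intro exI[of _ "v - u"] exI[of _ "snd u"]) simp
qed

end

text \<open>A recurrence at height \<open>snd v\<close> makes \<open>y\<close> agree with a
  translate of \<open>x\<close> in all lower rows. Since \<open>snd v\<close> is unbounded, these
  rows eventually show any given window of \<open>x\<close>.\<close>

lemma deterministic_returns_above:
  fixes Y :: "(int \<times> int \<Rightarrow> 'a) set"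
  assumes det: "\<forall>y\<in>Y. \<forall>z\<in>Y. (\<forall>m. 0 \<le> snd m \<and> snd m < s \<longrightarrow> y m = z m) \<longrightarrow>
      (\<forall>m. snd m < s \<longrightarrow> y m = z m)"
    and Ys: "\<And>x v. x \<in> Y \<Longrightarrow> shift v x \<in> Y" and s: "0 < s" and x: "x \<in> Y" and y: "y \<in> Y"
    and ret: "\<And>h. \<exists>v. h < snd v \<and> (\<forall>m. 0 \<le> snd m \<and> snd m < s \<longrightarrow> x (v + m) = y m)"
  shows "subpattern_le x y"
  unfolding subpattern_le_iff
proof (intro allI impI)
  fix A :: "(int \<times> int) set" assume "finite A"
  then obtain N where N: "\<And>m. m \<in> A \<Longrightarrow> \<bar>snd m\<bar> \<le> N"
    using finite_int_bound[of A snd] by blast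
  obtain v where v: "N < snd v" "\<forall>m. 0 \<le> snd m \<and> snd m < s \<longrightarrow> shift v x m = y m"
    using ret unfolding shift_def by blast
  then have eq: "\<forall>m. snd m < s \<longrightarrow> shift v x m = y m"
    using det Ys[OF x] y by blast
  have "y (- v + m) = x m" if "m \<in> A" for m
    using eq[rule_format, of "- v + m"] N[OF that] v(1) s by (simp add: shift_def)
  then show "\<exists>v. \<forall>m\<in>A. y (v + m) = x m" by blast
qed

text \<open>Two recurrences of one block determine the same rows below them, so their difference is
  a period there.\<close>

lemma deterministic_returns_below:
  fixes Y :: "(int \<times> int \<Rightarrow> 'a) set"
  assumes det: "\<forall>y\<in>Y. \<forall>z\<in>Y. (\<forall>m. 0 \<le> snd m \<and> snd m < s \<longrightarrow> y m = z m) \<longrightarrow>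
      (\<forall>m. snd m < s \<longrightarrow> y m = z m)"
    and Ys: "\<And>x v. x \<in> Y \<Longrightarrow> shift v x \<in> Y" and s: "0 < s" and x: "x \<in> Y"
    and ret: "\<And>h. \<exists>v. snd v < h \<and> (\<forall>m. 0 \<le> snd m \<and> snd m < s \<longrightarrow> x (v + m) = y m)"
  shows "\<exists>c h. snd c \<noteq> 0 \<and> (\<forall>m. snd m \<le> h \<longrightarrow> x (c + m) = x m)"
proof -
  obtain v where v: "\<forall>m. 0 \<le> snd m \<and> snd m < s \<longrightarrow> shift v x m = y m"
    using ret unfolding shift_def by blast
  obtain u where u: "snd u < snd v" "\<forall>m. 0 \<le> snd m \<and> snd m < s \<longrightarrow> shift u x m = y m"
    using ret unfolding shift_def by blast
  have "\<forall>m. 0 \<le> snd m \<and> snd m < s \<longrightarrow> shift v x m = shift u x m" using v u(2) by simp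
  then have eq: "\<forall>m. snd m < s \<longrightarrow> shift v x m = shift u x m"
    using det Ys[OF x] by blast
  have "x (v - u + m) = x m" if "snd m \<le> snd u" for m
    using eq[rule_format, of "m - u"] that s by (simp add: shift_def algebra_simps)
  then show ?thesis using u(1) by (intro exI[of _ "v - u"] exI[of _ "snd u"]) simp
qed

section \<open>Counting defects row by row and combining the cases\<close>

lemma card_defects_rows:
  fixes x :: "int \<times> int \<Rightarrow> 'a"
  assumes "\<And>b. finite {k. x (k, b) \<noteq> x (k + p, b)} \<and> card {k. x (k, b) \<noteq> x (k + p, b)} \<le> K"
  shows "finite (defects r p x) \<and> card (defects r p x) \<le> nat r * K"
proof -
  let ?D = "\<lambda>b. (\<lambda>k. (k, b)) ` {k. x (k, b) \<noteq> x (k + p, b)}"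
  have eq: "defects r p x = (\<Union>b\<in>{0..<r}. ?D b)"
    by (auto simp: defects_def)
  have le: "card (?D b) \<le> K" for b
    using assms[of b] card_image_le[of "{k. x (k, b) \<noteq> x (k + p, b)}" "\<lambda>k. (k, b)"] by linarith
  have "card (\<Union>b\<in>{0..<r}. ?D b) \<le> (\<Sum>b\<in>{0..<r}. card (?D b))"
    by (rule card_UN_le) simp
  also have "\<dots> \<le> nat r * K"
    using sum_bounded_above[of "{0..<r}" "\<lambda>b. card (?D b)" K] le by simp
  finally show ?thesis unfolding eq using assms by simp
qed

theorem corollary5p8:
  fixes S :: "'a set" and X :: "(int \<times> int \<Rightarrow> 'a) set"
  assumes "sft S X"
    and "bounded_signal_property S X"
    and "countable X \<or> downward_deterministic X"
  shows "\<exists>k::nat. \<not> (\<exists>x :: nat \<Rightarrow> int \<times> int \<Rightarrow> 'a.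
           (\<forall>i\<in>{1..k}. x i \<in> X) \<and> (\<forall>i\<in>{1..<k}. subpattern_less (x (i + 1)) (x i)))"
proof -
  obtain T :: "nat set" and X' and U :: "nat set" and Y where conj: "conjugate S X T X'"
    and Y: "sft U Y" "countable Y" and PS: "projective_subdynamics X' \<subseteq> Y"
    using assms(2) unfolding bounded_signal_property_def by blast
  have subX: "subshift S X" and subX': "subshift T X'" using conj by (auto simp: conjugate_def)
  have Xs: "\<forall>x\<in>X. \<forall>v. shift v x \<in> X" using subshift_shift[OF subX] by blast
  obtain f g A where bij: "bij_betw f X X'" and A: "finite A" "local_on A X f" "local_on A X' g"
    and ball: "\<forall>x\<in>X. g (f x) = x" "\<forall>y\<in>X'. f (g y) = y" "\<forall>x\<in>X. f x \<in> X'" "\<forall>y\<in>X'. g y \<in> X"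
      "\<forall>x\<in>X. \<forall>v. f (shift v x) = shift v (f x)" "\<forall>y\<in>X'. \<forall>v. g (shift v y) = shift v (g y)"
    using conjugate_local_inverse[OF conj] by (elim exE conjE)
  note gf = ball(1)[rule_format] and fg = ball(2)[rule_format] and fX' = ball(3)[rule_format]
    and gX = ball(4)[rule_format] and fs = ball(5)[rule_format] and gs = ball(6)[rule_format]
  obtain p K where p: "0 < p" and
    K: "\<forall>y\<in>Y. finite {k. y k \<noteq> y (k + p)} \<and> card {k. y k \<noteq> y (k + p)} \<le> K"
    using countable_sft_almost_periodic[OF Y] by blast
  \<comment> \<open>The projective subdynamics records the row at height 0; shift invariance brings
    every other row there.\<close>
  have rows: "finite {k. x (k, b) \<noteq> x (k + p, b)} \<and> card {k. x (k, b) \<noteq> x (k + p, b)} \<le> K"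
    if "x \<in> X'" for x b
  proof -
    have "(\<lambda>j. shift (0, b) x (j, 0)) \<in> Y"
      using PS subshift_shift[OF subX' that] unfolding projective_subdynamics_def by blast
    from K[rule_format, OF this] show ?thesis by (simp add: shift_def)
  qed
  have "\<exists>r>0. bounded_defects X' r p (nat r * K)"
    using assms(3)
  proof
    assume "countable X"
    then have cX': "countable X'" using bij by (metis bij_betw_def countable_image)
    obtain q where q: "0 < q" "glueable snd q X" using sft_glueable[OF assms(1), of snd] by auto
    obtain r where r: "0 < r" "glueable snd r X'"
      using conjugate_glueable[OF q(2,1) A fg fX' gX Xs] by blast
    interpret countable_glueable X' r
    proof
      show "z \<in> X'" if "\<And>A. finite A \<Longrightarrow> \<exists>x\<in>X'. \<forall>m\<in>A. x m = z m" for z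
      proof (rule closedin_full_shift_limit)
        show "closedin (full_shift T) X'" using subX' by (simp add: subshift_def)
      qed (rule that)
    qed (rule cX' r(2) subshift_shift[OF subX'], assumption?)+
    have "bounded_defects X' r p (nat r * K)"
    proof
      fix x y assume xy: "x \<in> X'" "y \<in> X'"
      show "subpattern_le x y \<or> (\<exists>c h. snd c \<noteq> 0 \<and> (\<forall>m. h \<le> snd m \<longrightarrow> x (c + m) = x m))"
        if "\<And>h. \<exists>v. h < snd v \<and> (\<forall>m. 0 \<le> snd m \<and> snd m < r \<longrightarrow> x (v + m) = y m)"
        using returns_above_period[OF r(1) xy(1) that] ..
      show "subpattern_le x y \<or> (\<exists>c h. snd c \<noteq> 0 \<and> (\<forall>m. snd m \<le> h \<longrightarrow> x (c + m) = x m))"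
        if "\<And>h. \<exists>v. snd v < h \<and> (\<forall>m. 0 \<le> snd m \<and> snd m < r \<longrightarrow> x (v + m) = y m)"
        using returns_below_period[OF r(1) xy(1) that] ..
    qed (rule r(1) p shift_closed card_defects_rows rows, assumption?)+
    then show ?thesis using r(1) by blast
  next
    assume "downward_deterministic X"
    then obtain r where r: "0 < r" and det: "\<forall>y\<in>X'. \<forall>z\<in>X'.
        (\<forall>m. 0 \<le> snd m \<and> snd m < r \<longrightarrow> y m = z m) \<longrightarrow> (\<forall>m. snd m < r \<longrightarrow> y m = z m)"
      using conjugate_deterministic[OF _ subX' A(1,3) fg gX] Xs by blast
    have "bounded_defects X' r p (nat r * K)"
    proof
      fix x y assume xy: "x \<in> X'" "y \<in> X'"
      show "subpattern_le x y \<or> (\<exists>c h. snd c \<noteq> 0 \<and> (\<forall>m. h \<le> snd m \<longrightarrow> x (c + m) = x m))"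
        if "\<And>h. \<exists>v. h < snd v \<and> (\<forall>m. 0 \<le> snd m \<and> snd m < r \<longrightarrow> x (v + m) = y m)"
        using deterministic_returns_above[OF det subshift_shift[OF subX'] r xy that] ..
      show "subpattern_le x y \<or> (\<exists>c h. snd c \<noteq> 0 \<and> (\<forall>m. snd m \<le> h \<longrightarrow> x (c + m) = x m))"
        if "\<And>h. \<exists>v. snd v < h \<and> (\<forall>m. 0 \<le> snd m \<and> snd m < r \<longrightarrow> x (v + m) = y m)"
        using deterministic_returns_below[OF det subshift_shift[OF subX'] r xy(1) that] ..
    qed (rule r p subshift_shift[OF subX'] card_defects_rows rows, assumption?)+
    then show ?thesis using r by blast
  qed
  then obtain L r where "bounded_defects X' r p L" by blast
  then interpret bounded_defects X' r p L .
  \<comment> \<open>Locality of \<open>f\<close> preserves the order and locality of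
    \<open>g\<close> reflects it, so strict chains in \<open>X\<close> become strict chains in
    \<open>X'\<close>.\<close>
  have less: "subpattern_less (f y) (f x)" if xy: "x \<in> X" "y \<in> X" "subpattern_less y x" for x y
  proof -
    have "subpattern_le (f y) (f x)"
      using xy local_map_subpattern_le[OF A(1,2) fs subshift_shift[OF subX]]
      by (simp add: subpattern_less_def)
    moreover have "\<not> subpattern_le (f x) (f y)"
    proof
      assume "subpattern_le (f x) (f y)"
      then have "subpattern_le (g (f x)) (g (f y))"
        using local_map_subpattern_le[OF A(1,3) gs subshift_shift[OF subX']] fX' xy(1,2) by blast
      then show False using xy gf by (simp add: subpattern_less_def)
    qed
    ultimately show ?thesis by (simp add: subpattern_less_def)
  qed
  have False if "\<forall>i\<in>{1..2 * L + 3}. x i \<in> X"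
    "\<forall>i\<in>{1..<2 * L + 3}. subpattern_less (x (i + 1)) (x i)" for x
    by (rule no_long_chain[of "\<lambda>i. f (x i)"]) (use that in \<open>auto intro!: fX' less\<close>)
  then show ?thesis by blast
qed

end
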